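(* Let $f: X\to X$ be a pc-map. Then $$h_{top}(f) = \lim_{n \to \infty} \frac{1}{n} \log c_n,$$ where $c_n:=\min\{\#\mathcal P : \mathcal P\in\Phi(f^n)\}$ is the smallest number of intervals on which $f^n$ is monotonic and essentially continuous.
   Context: **pc-maps.** Let $X\subset\mathbb R$ be a compact interval with non-empty interior, with the topology induced from $\mathbb R$. A pc-map (piecewise continuous interval map) is a map $f:X\to X$ together with finitely many pairwise disjoint non-empty intervals $X_1,\dots,X_N\subset X$ ($N\ge1$), open in $X$ (the continuity pieces), such that $X=\overline{X_1}\cup\dots\cup\overline{X_N}$, each $f|_{X_i}$ is continuous, and $f$ has finitely many critical points (points where $f$ is not locally invertible or where $f$ is discontinuous) within each continuity piece. The pieces are sorted: if $i<j$ then $x<y$ for all $x\in X_i$, $y\in X_j$. Put $\Delta_f:=\bigcup_{i=1}^N\partial X_i$, where $\partial$ is the boundary within $X$. By convention $f$ is continuous at the endpoints of $X$, and these do not belong to $\Delta_f$. Put $\widetilde X_f:=\bigcap_{n\ge0}f^{-n}(X\setminus\Delta_f)$. **Entropy.** A collection of $X$ is a set $\mathcal C$ of non-empty subsets of $X$. Put $f^{-j}(\mathcal C):=\{f^{-j}(C):C\in\mathcal C\}\setminus\{\emptyset\}$, $\mathcal C\setminus F:=\{C\setminus F:C\in\mathcal C\}\setminus\{\emptyset\}$, $\bigvee_{j}\mathcal C_j:=\{\bigcap_jC_j: C_j\in\mathcal C_j\ \forall j\}\setminus\{\emptyset\}$, and $\mathcal C^n:=\bigvee_{j=0}^{n-1}f^{-j}(\mathcal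 C\setminus\Delta_f)$. For non-empty $B$ and a cover $\mathcal C$ of $B$, $\aleph_B(\mathcal C)$ is the least cardinality of a sub-collection of $\mathcal C$ covering $B$. Then $$h_{top}(f,\mathcal C):=\lim_{n\to\infty}\frac{\log\aleph_{\widetilde X_f}(\mathcal C^n)}{n},\qquad h_{top}(f):=\sup\{h_{top}(f,\mathcal C):\mathcal C\text{ is an open cover of }X\}.$$ **The numbers $c_n$.** $\Phi(f^n)$ is the collection of all partitions $\mathcal P$ of $X$ into intervals with non-empty interior such that for all $P\in\mathcal P$ the restriction of $f^n$ to the interior of $P$ is monotonic and continuously extendable, i.e. every point in the interior of $P$ is either a point where $f^n$ is continuous or a removable discontinuity of $f^n$. *)

theory Defs
  imports "HOL-Analysis.Analysis"
begin

section \<open>Piecewise continuous interval maps\<close>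

text \<open>A self-map of the interval \<open>X\<close> is given by a total function on the reals of which only the
  values on \<open>X\<close> matter. All topological notions are relative to \<open>X\<close>, unless said otherwise. The
  continuity pieces are \<open>Q 1, \<dots>, Q N\<close>.\<close>

definition locally_invertible_at :: "real set \<Rightarrow> (real \<Rightarrow> real) \<Rightarrow> real \<Rightarrow> bool" where
  "locally_invertible_at X f x \<longleftrightarrow> (\<exists>U. openin (top_of_set X) U \<and> x \<in> U \<and> inj_on f U)"

definition critical_point :: "real set \<Rightarrow> (real \<Rightarrow> real) \<Rightarrow> real \<Rightarrow> bool" where
  "critical_point X f x \<longleftrightarrow>
     x \<in> X \<and> (\<not> locally_invertible_at X f x \<or> \<not> continuous (at x within X) f)"

definition Delta :: "real set \<Rightarrow> nat \<Rightarrow> (nat \<Rightarrow> real set) \<Rightarrow> real set" where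
  "Delta X N Q = (\<Union>i\<in>{1..N}. (top_of_set X) frontier_of (Q i))"

text \<open>In the last condition, \<open>frontier X\<close> is the boundary of \<open>X\<close> within the reals, that is,
  the set of the two endpoints of \<open>X\<close>.\<close>

definition pc_map ::
    "real set \<Rightarrow> (real \<Rightarrow> real) \<Rightarrow> nat \<Rightarrow> (nat \<Rightarrow> real set) \<Rightarrow> bool" where
  "pc_map X f N Q \<longleftrightarrow>
     is_interval X \<and> compact X \<and> interior X \<noteq> {} \<and>
     f ` X \<subseteq> X \<and>
     N \<ge> 1 \<and>
     (\<forall>i\<in>{1..N}. is_interval (Q i) \<and> Q i \<noteq> {} \<and> openin (top_of_set X) (Q i)) \<and>
     disjoint_family_on Q {1..N} \<and>
     X = (\<Union>i\<in>{1..N}. closure (Q i)) \<and>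
     (\<forall>i\<in>{1..N}. continuous_on (Q i) f) \<and>
     (\<forall>i\<in>{1..N}. finite {x \<in> Q i. critical_point X f x}) \<and>
     (\<forall>i\<in>{1..N}. \<forall>j\<in>{1..N}. i < j \<longrightarrow> (\<forall>x\<in>Q i. \<forall>y\<in>Q j. x < y)) \<and>
     (\<forall>e\<in>frontier X. continuous (at e within X) f \<and> e \<notin> Delta X N Q)"


section \<open>Topological entropy\<close>

text \<open>In this section \<open>\<Delta>\<close> is an arbitrary subset of \<open>X\<close>; it will be \<open>Delta X N Q\<close>.\<close>

definition preim :: "real set \<Rightarrow> (real \<Rightarrow> real) \<Rightarrow> nat \<Rightarrow> real set \<Rightarrow> real set" where
  "preim X f j A = {x \<in> X. (f ^^ j) x \<in> A}"

definition X_tilde :: "real set \<Rightarrow> (real \<Rightarrow> real) \<Rightarrow> real set \<Rightarrow> real set" where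
  "X_tilde X f \<Delta> = (\<Inter>n. preim X f n (X - \<Delta>))"

definition coll_preim ::
    "real set \<Rightarrow> (real \<Rightarrow> real) \<Rightarrow> nat \<Rightarrow> real set set \<Rightarrow> real set set" where
  "coll_preim X f j C = preim X f j ` C - {{}}"

definition coll_diff :: "real set set \<Rightarrow> real set \<Rightarrow> real set set" where
  "coll_diff C F = (\<lambda>A. A - F) ` C - {{}}"

definition coll_join :: "nat \<Rightarrow> (nat \<Rightarrow> real set set) \<Rightarrow> real set set" where
  "coll_join n C = {(\<Inter>j\<in>{..<n}. A j) | A. \<forall>j<n. A j \<in> C j} - {{}}"

definition coll_iter ::
    "real set \<Rightarrow> (real \<Rightarrow> real) \<Rightarrow> real set \<Rightarrow> real set set \<Rightarrow> nat \<Rightarrow> real set set" where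
  "coll_iter X f \<Delta> C n = coll_join n (\<lambda>j. coll_preim X f j (coll_diff C \<Delta>))"

text \<open>The cardinality of a smallest subcollection of \<open>C\<close> covering \<open>B\<close>. This is used only where
  there is a finite such subcollection: if \<open>C\<close> is an open cover of the compact set \<open>X\<close>, and
  \<open>D \<subseteq> C\<close> is a finite subcover, then the finite collection \<open>coll_iter X f \<Delta> D n\<close> covers
  \<open>X_tilde X f \<Delta>\<close>.\<close>

definition aleph :: "real set \<Rightarrow> real set set \<Rightarrow> nat" where
  "aleph B C = (LEAST k. \<exists>D\<subseteq>C. finite D \<and> B \<subseteq> \<Union>D \<and> card D = k)"

definition open_cover :: "real set \<Rightarrow> real set set \<Rightarrow> bool" where
  "open_cover X C \<longleftrightarrow> (\<forall>A\<in>C. A \<noteq> {} \<and> openin (top_of_set X) A) \<and> X \<subseteq> \<Union>C"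

text \<open>The limit exists, because the sequence of the \<open>ln (aleph \<dots>)\<close> is subadditive.\<close>

definition htop_cover ::
    "real set \<Rightarrow> (real \<Rightarrow> real) \<Rightarrow> real set \<Rightarrow> real set set \<Rightarrow> real" where
  "htop_cover X f \<Delta> C =
     lim (\<lambda>n. ln (real (aleph (X_tilde X f \<Delta>) (coll_iter X f \<Delta> C n))) / real n)"

definition htop :: "real set \<Rightarrow> (real \<Rightarrow> real) \<Rightarrow> real set \<Rightarrow> ereal" where
  "htop X f \<Delta> = (SUP C\<in>{C. open_cover X C}. ereal (htop_cover X f \<Delta> C))"


section \<open>Intervals of monotonicity and essential continuity\<close>

definition removable_discontinuity :: "real set \<Rightarrow> (real \<Rightarrow> real) \<Rightarrow> real \<Rightarrow> bool" where
  "removable_discontinuity X g x \<longleftrightarrow>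
     \<not> continuous (at x within X) g \<and> (\<exists>l. (g \<longlongrightarrow> l) (at x within X))"

text \<open>Here \<open>interior\<close> is the interior within the reals. In particular no condition is imposed at
  the endpoints of \<open>X\<close>, where an iterate of a pc-map need not be continuous. Monotonicity is
  required at all points of \<open>interior P\<close>, including those with a discontinuity.\<close>

definition Phi :: "real set \<Rightarrow> (real \<Rightarrow> real) \<Rightarrow> real set set set" where
  "Phi X g = {\<P>. partition_on X \<P> \<and>
     (\<forall>P\<in>\<P>. is_interval P \<and> interior P \<noteq> {} \<and>
        (mono_on (interior P) g \<or> antimono_on (interior P) g) \<and>
        (\<forall>x\<in>interior P. continuous (at x within X) g \<or> removable_discontinuity X g x))}"

text \<open>\<open>Phi\<close> also contains infinite partitions, whose \<open>card\<close> would be \<open>0\<close>. They do not affect the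
  minimum, as \<open>Phi X (f ^^ n)\<close> contains a finite partition if \<open>f\<close> is a pc-map.\<close>

definition lap_count :: "real set \<Rightarrow> (real \<Rightarrow> real) \<Rightarrow> nat \<Rightarrow> nat" where
  "lap_count X f n = (LEAST k. \<exists>\<P>\<in>Phi X (f ^^ n). finite \<P> \<and> card \<P> = k)"

end

theory Submission imports Defs "HOL-Real_Asymp.Real_Asymp"
begin

text \<open>Let \<open>E\<close> be the finite set of critical points of \<open>f\<close>, let \<open>E\<^sub>n\<close> (the \<open>cut_set\<close>) be the set of
  points whose orbit meets \<open>E\<close> before time \<open>n\<close>, and let \<open>u\<^sub>n\<close> (the number \<open>laps n\<close>) be
  \<open>card E\<^sub>n + 1\<close>. Between neighbouring points of \<open>E\<^sub>n\<close> the iterate \<open>f ^^ n\<close> is continuous and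
  injective, so it takes each value at most once there. Therefore \<open>u\<^sub>n\<^sub>+\<^sub>m \<le> u\<^sub>n u\<^sub>m\<close>, and
  \<open>ln u\<^sub>n / n\<close> converges to a number \<open>\<lambda>\<close> (\<open>lap_growth\<close>) by Fekete's lemma. Both sides of the
  theorem turn out to be \<open>\<lambda>\<close>.

  \<^bold>\<open>Entropy.\<close> For an open cover there is a finite set \<open>T\<close> such that every interval avoiding \<open>T\<close>
  lies in one set of the cover. Cutting \<open>X\<close> also at the points whose orbit meets \<open>T\<close> before time
  \<open>n\<close> increases the number of gaps only by a factor that is linear in \<open>n\<close>, and each gap needs only
  one element of the iterated cover. So the entropy is at most \<open>\<lambda>\<close> (lemma
  \<open>htop_cover_le_lap_growth\<close>). For the converse, the difficulty is that a set of the cover does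
  not separate the two sides of a discontinuity or of a turning point, so that a factor \<open>2\<close> might
  be lost at each time step. But a cover chosen fine enough for \<open>E\<^sub>k\<close> has only sets that meet at
  most two gaps of \<open>E\<^sub>k\<close>, and then a factor \<open>2\<close> is lost only once in \<open>k\<close> steps. This gives a cover
  of entropy at least \<open>\<lambda> - ln 2 / k\<close> (lemma \<open>lap_growth_le_htop_cover\<close>).

  \<^bold>\<open>Lap numbers.\<close> Cutting \<open>X\<close> at \<open>E\<^sub>n\<close> yields \<open>c\<^sub>n \<le> u\<^sub>n\<close> for the lap count \<open>c\<^sub>n\<close> (lemma
  \<open>partition_at_cuts\<close>). Conversely, \<open>c\<^sub>n\<close> can be smaller than \<open>u\<^sub>n\<close>, since a later iterate of \<open>f\<close>
  can undo a jump. But fix \<open>k\<close> and a partition for \<open>f ^^ k\<close> into \<open>c\<^sub>k\<close> intervals. The endpoints of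
  these contain the critical points of \<open>f ^^ k\<close>, so the argument for submultiplicativity applies
  to \<open>f ^^ k\<close> with these endpoints as cuts and bounds the number of laps of \<open>(f ^^ k) ^^ m\<close> by
  \<open>(3 c\<^sub>k) ^ m\<close>. The set \<open>E\<^sub>k\<^sub>m\<close> is the pullback of the finite set \<open>E\<^sub>k\<close> under the first \<open>m\<close>
  iterates of \<open>f ^^ k\<close>, whence \<open>u\<^sub>k\<^sub>m\<close> is at most \<open>(3 c\<^sub>k) ^ m\<close> up to a factor that is linear in
  \<open>m\<close>. So \<open>\<lambda> \<le> ln (3 c\<^sub>k) / k\<close> for every \<open>k\<close> (lemma \<open>lap_growth_le_partition\<close>). The crude constant
  \<open>3\<close> disappears as \<open>k\<close> tends to infinity.\<close>

section \<open>Subadditive sequences\<close>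

text \<open>Fekete's lemma: writing \<open>n = q k + r\<close> with \<open>r < k\<close> shows that eventually the
  quotients exceed \<open>u k / k\<close> by at most an arbitrarily small amount, for every \<open>k\<close>; so they
  converge to their infimum.\<close>

lemma fekete:
  fixes u :: "nat \<Rightarrow> real"
  assumes nonneg: "\<And>n. 0 \<le> u n" and sub: "\<And>m n. u (m + n) \<le> u m + u n"
  shows "convergent (\<lambda>n. u n / real n)"
proof -
  define A where "A = (\<lambda>n. u n / real n) ` {1..}"
  define L where "L = Inf A"
  have bdd: "bdd_below A"
    using nonneg by (auto simp: A_def intro!: bdd_belowI[of _ 0])
  have mult: "u (q * k + r) \<le> real q * u k + u r" for q k r
  proof (induction q)
    case (Suc q)
    have "u (Suc q * k + r) \<le> u k + u (q * k + r)"
      using sub[of k "q * k + r"] by (simp add: ac_simps)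
    with Suc show ?case by (simp add: algebra_simps)
  qed simp
  have "(\<lambda>n. u n / real n) \<longlonglongrightarrow> L"
  proof (rule LIMSEQ_I)
    fix e :: real assume e: "0 < e"
    have "\<exists>a\<in>A. a < L + e / 2"
      using cInf_less_iff[of A "L + e / 2"] bdd e by (auto simp: L_def A_def)
    then obtain k where k: "1 \<le> k" "u k / real k < L + e / 2"
      by (auto simp: A_def)
    define M where "M = (\<Sum>r<k. u r)"
    have M: "u r \<le> M" if "r < k" for r
      unfolding M_def using that nonneg by (intro member_le_sum) auto
    obtain n0 :: nat where n0: "2 * M / e < real n0"
      using reals_Archimedean2 by blast
    have "norm (u n / real n - L) < e" if n: "n0 \<le> n" "1 \<le> n" for n
    proof -
      have "L \<le> u n / real n"
        unfolding L_def using n bdd by (intro cInf_lower) (auto simp: A_def)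
      moreover have "u n / real n < L + e"
      proof -
        have "u n \<le> real (n div k) * u k + M"
          using mult[of "n div k" k "n mod k"] M[of "n mod k"] k by simp
        also have "real (n div k) * u k \<le> real n / real k * u k"
          using nonneg of_nat_div_le_of_nat by (intro mult_right_mono) auto
        finally have "u n / real n \<le> u k / real k + M / real n"
          using n k by (simp add: field_simps)
        moreover have "M / real n < e / 2"
        proof -
          have "2 * M / e < real n" using n0 n by linarith
          then show ?thesis using e n by (simp add: field_simps)
        qed
        ultimately show ?thesis using k by linarith
      qed
      ultimately show ?thesis by simp
    qed
    then show "\<exists>no. \<forall>n\<ge>no. norm (u n / real n - L) < e"
      by (intro exI[of _ "max n0 1"]) auto
  qed
  then show ?thesis by (auto simp: convergent_def)
qed

section \<open>Cut points of the iterates\<close>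

text \<open>Injectivity is a local-to-global argument. If \<open>g\<close> took the same value at \<open>x < y\<close>, then it would have a
  maximum or a minimum over \<open>{x..y}\<close> in the interior of that interval; but near an interior point
  \<open>g\<close> is continuous and injective, hence strictly monotone.\<close>

lemma no_critical_point_imp:
  assumes J: "is_interval J" "J \<subseteq> X" and nc: "\<And>x. x \<in> J \<Longrightarrow> \<not> critical_point X g x"
  shows "continuous_on J g" and "inj_on g J"
proof -
  show cont: "continuous_on J g"
    unfolding continuous_on_eq_continuous_within
  proof
    fix x assume "x \<in> J"
    with nc J have "continuous (at x within X) g"
      by (auto simp: critical_point_def)
    then show "continuous (at x within J) g"
      using J(2) continuous_within_subset by blast
  qed
  have no_ext: False
    if xy: "x \<in> J" "y \<in> J" and z: "x < z" "z < y"
      and ext: "(\<forall>t\<in>{x..y}. g t \<le> g z) \<or> (\<forall>t\<in>{x..y}. g z \<le> g t)" for x y z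
  proof -
    \<comment> \<open>Local injectivity at \<open>z\<close> makes \<open>g\<close> strictly monotone on \<open>{z - d..z + d}\<close>.\<close>
    have sub: "{x..y} \<subseteq> J"
      using mem_is_interval_1_I[OF J(1) xy] by auto
    then have "z \<in> J" using z by auto
    with nc J obtain U where U: "openin (top_of_set X) U" "z \<in> U" "inj_on g U"
      by (auto simp: critical_point_def locally_invertible_at_def)
    then obtain T where T: "open T" "U = X \<inter> T" by (auto simp: openin_open)
    with U obtain e where e: "e > 0" "ball z e \<subseteq> T" by (meson IntE openE)
    define d where "d = min (e / 2) (min (z - x) (y - z))"
    have d: "0 < d" "d < e" "x \<le> z - d" "z + d \<le> y"
      using e z by (auto simp: d_def)
    have in_xy: "{z - d..z + d} \<subseteq> {x..y}" using d by auto
    have "{z - d..z + d} \<subseteq> U"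
      using in_xy sub J(2) e d T(2) by (auto simp: dist_real_def subset_iff)
    then have "inj_on g {z - d..z + d}" using U(3) inj_on_subset by blast
    moreover have "continuous_on {z - d..z + d} g"
      using cont in_xy sub continuous_on_subset by blast
    ultimately have "g (z - d) < g z \<and> g z < g (z + d) \<or> g (z + d) < g z \<and> g z < g (z - d)"
      using continuous_inj_imp_mono[of "z - d" z "z + d" g] d by auto
    moreover have "z - d \<in> {x..y}" "z + d \<in> {x..y}" using d in_xy by auto
    ultimately show False using ext by force
  qed
  have "g x \<noteq> g y" if xy: "x \<in> J" "y \<in> J" "x < y" for x y
  proof
    assume eq: "g x = g y"
    have "{x..y} \<subseteq> J" using mem_is_interval_1_I[OF J(1) xy(1,2)] by auto
    then have c: "continuous_on {x..y} g" using cont continuous_on_subset by blast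
    obtain z where z: "z \<in> {x..y}" "\<forall>t\<in>{x..y}. g t \<le> g z"
      using continuous_attains_sup[of "{x..y}" g] c xy by auto
    obtain w where w: "w \<in> {x..y}" "\<forall>t\<in>{x..y}. g w \<le> g t"
      using continuous_attains_inf[of "{x..y}" g] c xy by auto
    show False
    proof (cases "z \<in> {x, y} \<and> w \<in> {x, y}")
      case True
      then have zw: "g z = g x" "g w = g x" using eq by auto
      define t where "t = (x + y) / 2"
      have t: "x < t" "t < y" using xy by (auto simp: t_def)
      then have "g t = g x" using z w zw by (intro antisym) auto
      then show False using no_ext[OF xy(1,2) t] z w zw by simp
    next
      case False
      then consider "x < z" "z < y" | "x < w" "w < y" using z(1) w(1) by force
      then show False using no_ext[OF xy(1,2)] z(2) w(2) by cases blast+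
    qed
  qed
  then show "inj_on g J" by (intro linorder_inj_onI) auto
qed

text \<open>The points whose orbit meets \<open>F\<close> before time \<open>n\<close>. If \<open>F\<close> is finite and contains
  the critical points of \<open>g\<close>, then this set contains the critical points of \<open>g ^^ n\<close>.\<close>

definition cut_set :: "real set \<Rightarrow> (real \<Rightarrow> real) \<Rightarrow> real set \<Rightarrow> nat \<Rightarrow> real set" where
  "cut_set X g F n = {x \<in> X. \<exists>j<n. (g ^^ j) x \<in> F}"

text \<open>Between two neighbouring points of \<open>S\<close> each value is taken at most once. So a point outside
  \<open>S\<close> with image in \<open>T\<close> is determined by its image and by the number of points of \<open>S\<close> to its
  left, which is one of \<open>card S + 1\<close> numbers. Bounding the union with \<open>S\<close> rather than the preimage
  alone is what makes the count of laps below exactly submultiplicative.\<close>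

lemma card_preimage_le:
  fixes X S :: "real set" and h :: "real \<Rightarrow> 'a"
  assumes X: "is_interval X" and S: "finite S" and T: "finite T"
    and inj: "\<And>J. is_interval J \<Longrightarrow> J \<subseteq> X - S \<Longrightarrow> inj_on h J"
  shows "finite {x \<in> X. h x \<in> T}"
    and "card (S \<union> {x \<in> X. h x \<in> T}) \<le> card S + (card S + 1) * card T"
proof -
  define R where "R = {x \<in> X - S. h x \<in> T}"
  let ?\<phi> = "\<lambda>x. (card {s \<in> S. s < x}, h x)"
  have ne: "?\<phi> x \<noteq> ?\<phi> y" if xy: "x \<in> R" "y \<in> R" "x < y" for x y
  proof
    assume eq: "?\<phi> x = ?\<phi> y"
    have "{s \<in> S. s < x} = {s \<in> S. s < y}"
      using S eq xy by (intro card_subset_eq) auto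
    then have "s < x \<longleftrightarrow> s < y" if "s \<in> S" for s using that by blast
    moreover have "y \<notin> S" using xy by (simp add: R_def)
    ultimately have "{x..y} \<inter> S = {}" by (metis Int_iff atLeastAtMost_iff ex_in_conv leD order_le_less)
    moreover have "{x..y} \<subseteq> X"
      using mem_is_interval_1_I[OF X, of x y] xy by (auto simp: R_def)
    ultimately have "inj_on h {x..y}" by (intro inj) auto
    from inj_onD[OF this, of x y] eq xy show False by simp
  qed
  then have inj_\<phi>: "inj_on ?\<phi> R" by (intro linorder_inj_onI) auto
  have img: "?\<phi> ` R \<subseteq> {..card S} \<times> T"
    using S by (auto simp: R_def intro: card_mono)
  have finR: "finite R" using inj_on_finite[OF inj_\<phi> img] T by auto
  have "card R \<le> (card S + 1) * card T"
    using card_inj_on_le[OF inj_\<phi> img] T by (simp add: card_cartesian_product)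
  moreover have eqU: "S \<union> {x \<in> X. h x \<in> T} = S \<union> R" by (auto simp: R_def)
  ultimately show "card (S \<union> {x \<in> X. h x \<in> T}) \<le> card S + (card S + 1) * card T"
    using card_Un_le[of S R] by simp
  show "finite {x \<in> X. h x \<in> T}"
    using eqU finR S by (metis finite_Un)
qed

text \<open>The set \<open>F\<close> may be larger than the set of critical points. This freedom is used for iterates
  of a pc-map, where \<open>F\<close> consists of the endpoints of the intervals of a given partition.\<close>

locale cut_map =
  fixes X :: "real set" and g :: "real \<Rightarrow> real" and F :: "real set"
  assumes interval: "is_interval X" and maps: "g ` X \<subseteq> X" and finite_F: "finite F"
    and critical: "\<And>x. critical_point X g x \<Longrightarrow> x \<in> F"
begin

lemma iter_in: "x \<in> X \<Longrightarrow> (g ^^ n) x \<in> X"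
  using maps by (induction n) auto

lemma iter_between_cuts:
  assumes "is_interval J" "J \<subseteq> X - cut_set X g F n" "i \<le> n"
  shows "continuous_on J (g ^^ i) \<and> inj_on (g ^^ i) J"
  using assms(3)
proof (induction i)
  case (Suc i)
  let ?J = "(g ^^ i) ` J"
  from Suc have c: "continuous_on J (g ^^ i)" and j: "inj_on (g ^^ i) J" by auto
  have int: "is_interval ?J"
    using connected_continuous_image[OF c] assms(1) by (simp add: is_interval_connected_1)
  have "?J \<subseteq> X - F"
    using assms(2) iter_in Suc.prems by (fastforce simp: cut_set_def)
  then have "continuous_on ?J g" "inj_on g ?J"
    using no_critical_point_imp[OF int, of X g] critical by auto
  then show ?case
    using continuous_on_compose[OF c, of g] comp_inj_on[OF j, of g] by (simp add: comp_def)
qed auto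

lemma cut_set_add:
  "cut_set X g F (n + m) = cut_set X g F n \<union> {x \<in> X. (g ^^ n) x \<in> cut_set X g F m}"
proof -
  have split: "j < n + m \<longleftrightarrow> j < n \<or> (\<exists>i<m. j = i + n)" for j by presburger
  have "(\<exists>j<n + m. (g ^^ j) x \<in> F) \<longleftrightarrow>
      (\<exists>j<n. (g ^^ j) x \<in> F) \<or> (\<exists>j<m. (g ^^ j) ((g ^^ n) x) \<in> F)" for x
  proof -
    have "(\<exists>j<n + m. (g ^^ j) x \<in> F) \<longleftrightarrow>
        (\<exists>j<n. (g ^^ j) x \<in> F) \<or> (\<exists>i<m. (g ^^ (i + n)) x \<in> F)"
      unfolding split by blast
    then show ?thesis by (simp only: funpow_add comp_apply)
  qed
  then show ?thesis unfolding cut_set_def using iter_in by blast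
qed

lemma card_iter_preimage_le:
  assumes "finite (cut_set X g F n)" "finite T"
  shows "finite {x \<in> X. (g ^^ n) x \<in> T}"
    and "card (cut_set X g F n \<union> {x \<in> X. (g ^^ n) x \<in> T})
      \<le> card (cut_set X g F n) + (card (cut_set X g F n) + 1) * card T"
  using card_preimage_le[OF interval assms, of "g ^^ n"] iter_between_cuts[of _ n n] by auto

lemma finite_cut_set: "finite (cut_set X g F n)"
proof (induction n)
  case 0 show ?case by (simp add: cut_set_def)
next
  case (Suc n)
  have "cut_set X g F 1 \<subseteq> F" by (auto simp: cut_set_def)
  then have "finite (cut_set X g F 1)" using finite_F finite_subset by blast
  then show ?case
    using cut_set_add[of n 1] card_iter_preimage_le[OF Suc] Suc by simp
qed

lemma finite_iter_preimage: "finite T \<Longrightarrow> finite {x \<in> X. (g ^^ n) x \<in> T}"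
  using card_iter_preimage_le finite_cut_set by blast

text \<open>The number of intervals into which the cut points divide \<open>X\<close>, except that a cut point at an
  endpoint of \<open>X\<close> is counted as if it created an interval, too.\<close>

definition laps :: "nat \<Rightarrow> nat" where
  "laps n = card (cut_set X g F n) + 1"

lemma laps_add: "laps (n + m) \<le> laps n * laps m"
  using card_iter_preimage_le(2)[OF finite_cut_set finite_cut_set, of n m] cut_set_add[of n m]
  by (simp add: laps_def algebra_simps)

lemma laps_mono: "n \<le> m \<Longrightarrow> laps n \<le> laps m"
  unfolding laps_def using finite_cut_set
  by (intro add_right_mono card_mono) (auto simp: cut_set_def intro: order.strict_trans2)

lemma laps_le_power: "laps n \<le> (card F + 1) ^ n"
proof (induction n)
  case 0 show ?case by (simp add: laps_def cut_set_def)
next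
  case (Suc n)
  have "laps 1 \<le> card F + 1"
    unfolding laps_def using finite_F by (auto simp: cut_set_def intro!: card_mono)
  with Suc have "laps n * laps 1 \<le> (card F + 1) ^ n * (card F + 1)" by (intro mult_le_mono)
  with laps_add[of n 1] have "laps (n + 1) \<le> (card F + 1) ^ n * (card F + 1)" by (rule order.trans)
  then show ?case by (simp add: mult.commute)
qed

text \<open>Pulling back a further finite set \<open>T\<close> along the first \<open>n\<close> iterates adds only a number of
  points that is linear in \<open>n\<close> times the number of laps: it does not change exponential
  growth rates.\<close>

lemma cut_set_other:
  assumes T: "finite T"
  shows "finite (cut_set X g T n)" and "card (cut_set X g T n) \<le> n * (laps n * (card T + 1))"
proof -
  have eq: "cut_set X g T n = (\<Union>j<n. {x \<in> X. (g ^^ j) x \<in> T})" by (auto simp: cut_set_def)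
  show "finite (cut_set X g T n)" unfolding eq using finite_iter_preimage[OF T] by blast
  have "card {x \<in> X. (g ^^ j) x \<in> T} \<le> laps n * (card T + 1)" if "j < n" for j
  proof -
    have "card {x \<in> X. (g ^^ j) x \<in> T} \<le> card (cut_set X g F j \<union> {x \<in> X. (g ^^ j) x \<in> T})"
      using finite_cut_set finite_iter_preimage[OF T] by (intro card_mono) auto
    also have "\<dots> \<le> laps j * (card T + 1)"
      using card_iter_preimage_le(2)[OF finite_cut_set T, of j]
      by (simp add: laps_def algebra_simps)
    also have "\<dots> \<le> laps n * (card T + 1)"
      using laps_mono that by (intro mult_right_mono) auto
    finally show ?thesis .
  qed
  then have "card (cut_set X g T n) \<le> (\<Sum>j<n. laps n * (card T + 1))"
    unfolding eq by (intro order.trans[OF card_UN_le] sum_mono) auto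
  then show "card (cut_set X g T n) \<le> n * (laps n * (card T + 1))" by simp
qed

end

section \<open>Covers and their least subcovers\<close>

text \<open>The requirements in the definition that the intermediate sets be non-empty follow from
  non-emptiness of the intersection. For \<open>n = 0\<close> the intersection is \<open>UNIV\<close>.\<close>

lemma coll_iter_iff:
  "A \<in> coll_iter X f D C n \<longleftrightarrow>
     A \<noteq> {} \<and> (\<exists>c. (\<forall>j<n. c j \<in> C) \<and> A = (\<Inter>j<n. preim X f j (c j - D)))"
proof
  assume A: "A \<in> coll_iter X f D C n"
  then obtain B where B: "A = (\<Inter>j<n. B j)" "\<forall>j<n. B j \<in> coll_preim X f j (coll_diff C D)" "A \<noteq> {}"
    by (auto simp: coll_iter_def coll_join_def)
  have "\<forall>j<n. \<exists>c\<in>C. B j = preim X f j (c - D)"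
    using B(2) by (auto simp: coll_preim_def coll_diff_def)
  then obtain c where "\<forall>j<n. c j \<in> C \<and> B j = preim X f j (c j - D)"
    by metis
  with B show "A \<noteq> {} \<and> (\<exists>c. (\<forall>j<n. c j \<in> C) \<and> A = (\<Inter>j<n. preim X f j (c j - D)))"
    by (intro conjI exI[of _ c]) auto
next
  assume "A \<noteq> {} \<and> (\<exists>c. (\<forall>j<n. c j \<in> C) \<and> A = (\<Inter>j<n. preim X f j (c j - D)))"
  then obtain c where c: "\<forall>j<n. c j \<in> C" "A = (\<Inter>j<n. preim X f j (c j - D))" and ne: "A \<noteq> {}"
    by blast
  have "preim X f j (c j - D) \<in> coll_preim X f j (coll_diff C D)" if j: "j < n" for j
  proof -
    have "preim X f j (c j - D) \<noteq> {}" using ne c j by blast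
    moreover from this have "c j - D \<noteq> {}" by (auto simp: preim_def)
    ultimately show ?thesis using c j by (auto simp: coll_preim_def coll_diff_def)
  qed
  with c ne show "A \<in> coll_iter X f D C n"
    unfolding coll_iter_def coll_join_def
    by (intro DiffI CollectI exI[of _ "\<lambda>j. preim X f j (c j - D)"]) auto
qed

lemma aleph_le:
  assumes "E \<subseteq> C" "finite E" "B \<subseteq> \<Union>E"
  shows "aleph B C \<le> card E"
  unfolding aleph_def using assms by (intro Least_le) auto

lemma aleph_attained:
  assumes "E \<subseteq> C" "finite E" "B \<subseteq> \<Union>E"
  obtains E' where "E' \<subseteq> C" "finite E'" "B \<subseteq> \<Union>E'" "card E' = aleph B C"
proof -
  have "\<exists>E'\<subseteq>C. finite E' \<and> B \<subseteq> \<Union>E' \<and> card E' = aleph B C"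
    unfolding aleph_def by (rule LeastI[of _ "card E"]) (use assms in auto)
  then show ?thesis using that by blast
qed

lemma finite_subcover_of_classes:
  fixes \<kappa> :: "'a \<Rightarrow> 'b"
  assumes V: "finite V" "\<kappa> ` B \<subseteq> V"
    and cov: "\<And>x. x \<in> B \<Longrightarrow> \<exists>A\<in>C. {y \<in> B. \<kappa> y = \<kappa> x} \<subseteq> A"
  obtains E where "E \<subseteq> C" "finite E" "B \<subseteq> \<Union>E" "card E \<le> card V"
proof -
  have "\<forall>v\<in>\<kappa> ` B. \<exists>A. A \<in> C \<and> {y \<in> B. \<kappa> y = v} \<subseteq> A"
    using cov by blast
  then obtain A where A: "\<And>v. v \<in> \<kappa> ` B \<Longrightarrow> A v \<in> C \<and> {y \<in> B. \<kappa> y = v} \<subseteq> A v"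
    by metis
  have fin: "finite (\<kappa> ` B)" using V finite_subset by blast
  show ?thesis
  proof (rule that[of "A ` \<kappa> ` B"])
    show "card (A ` \<kappa> ` B) \<le> card V"
      using card_image_le[OF fin, of A] card_mono[OF V] by linarith
    show "B \<subseteq> \<Union>(A ` \<kappa> ` B)" using A by blast
  qed (use A fin in auto)
qed

text \<open>\<open>T\<close> is a net so fine that every interval avoiding it is shorter than a Lebesgue number of
  the cover.\<close>

lemma open_cover_cuts:
  assumes X: "compact X" and C: "open_cover X C"
  obtains T where "finite T"
    "\<And>J. is_interval J \<Longrightarrow> J \<noteq> {} \<Longrightarrow> J \<subseteq> X - T \<Longrightarrow> \<exists>A\<in>C. J \<subseteq> A"
proof (cases "X = {}")
  case True
  then show ?thesis using that[of "{}"] by auto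
next
  case False
  define O' where "O' = {U. open U \<and> X \<inter> U \<in> C}"
  have "X \<subseteq> \<Union>O'"
  proof
    fix x assume x: "x \<in> X"
    with C obtain A where A: "A \<in> C" "x \<in> A" by (auto simp: open_cover_def)
    with C have "openin (top_of_set X) A" by (auto simp: open_cover_def)
    then obtain U where "open U" "A = X \<inter> U" by (auto simp: openin_open)
    with A show "x \<in> \<Union>O'" by (auto simp: O'_def)
  qed
  moreover from this False have "O' \<noteq> {}" by auto
  moreover have "open U" if "U \<in> O'" for U using that by (simp add: O'_def)
  ultimately obtain \<delta> where \<delta>: "0 < \<delta>" "\<And>T. T \<subseteq> X \<Longrightarrow> diameter T < \<delta> \<Longrightarrow> \<exists>B\<in>O'. T \<subseteq> B"
    using Lebesgue_number_lemma[OF X] by metis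
  obtain T where T: "finite T" "X \<subseteq> (\<Union>t\<in>T. ball t (\<delta> / 4))"
    using X[unfolded compact_eq_totally_bounded, THEN conjunct2, rule_format, of "\<delta> / 4"] \<delta>(1)
    by auto
  show ?thesis
  proof (rule that[OF T(1)])
    fix J assume J: "is_interval J" "J \<noteq> {}" "J \<subseteq> X - T"
    have close: "y - x \<le> \<delta> / 2" if xy: "x \<in> J" "y \<in> J" for x y
    proof (rule ccontr)
      assume far: "\<not> y - x \<le> \<delta> / 2"
      have sub: "{x..y} \<subseteq> J" using mem_is_interval_1_I[OF J(1) xy] by auto
      define z where "z = (x + y) / 2"
      have z: "x + \<delta> / 4 < z" "z < y - \<delta> / 4" using far by (auto simp: z_def field_simps)
      then have "z \<in> {x..y}" using \<delta>(1) by auto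
      then have "z \<in> X" using sub J(3) by blast
      then obtain t where t: "t \<in> T" "dist t z < \<delta> / 4" using T(2) by auto
      have "\<bar>t - z\<bar> < \<delta> / 4" using t(2) by (simp add: dist_real_def)
      with z have "t \<in> {x..y}" unfolding abs_less_iff atLeastAtMost_iff by linarith
      with sub J t show False by auto
    qed
    have "diameter J \<le> \<delta> / 2"
    proof (rule diameter_le)
      fix x y assume xy: "x \<in> J" "y \<in> J"
      show "norm (x - y) \<le> \<delta> / 2" using close[OF xy] close[OF xy(2,1)] unfolding real_norm_def by linarith
    qed (use J(2) in simp)
    then obtain U where "U \<in> O'" "J \<subseteq> U" using \<delta>(2)[of J] \<delta>(1) J by auto
    then have "X \<inter> U \<in> C" "J \<subseteq> X \<inter> U" using J by (auto simp: O'_def)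
    then show "\<exists>A\<in>C. J \<subseteq> A" by blast
  qed
qed

text \<open>The position of \<open>x\<close> relative to \<open>S\<close>: adding the two counts gives every point of \<open>S\<close> and every
  gap between neighbouring points of \<open>S\<close> a value of its own, an odd one for points and an even
  one for gaps.\<close>

definition position :: "real set \<Rightarrow> real \<Rightarrow> nat" where
  "position S x = card {s \<in> S. s < x} + card {s \<in> S. s \<le> x}"

lemma position_le:
  assumes "finite S" shows "position S x \<le> 2 * card S"
  using card_mono[of S "{s \<in> S. s < x}"] card_mono[of S "{s \<in> S. s \<le> x}"] assms
  by (auto simp: position_def)

lemma position_eq_imp_disjoint:
  assumes "finite S" "position S x = position S y" "x < y"
  shows "S \<inter> {x..y} = {}"
proof -
  have 1: "{s \<in> S. s < x} \<subseteq> {s \<in> S. s < y}" and 2: "{s \<in> S. s \<le> x} \<subseteq> {s \<in> S. s \<le> y}"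
    using assms by auto
  have "card {s \<in> S. s < x} = card {s \<in> S. s < y}" "card {s \<in> S. s \<le> x} = card {s \<in> S. s \<le> y}"
    using card_mono[OF _ 1] card_mono[OF _ 2] assms by (auto simp: position_def)
  then have "{s \<in> S. s < x} = {s \<in> S. s < y}" "{s \<in> S. s \<le> x} = {s \<in> S. s \<le> y}"
    using card_subset_eq[OF _ 1] card_subset_eq[OF _ 2] assms by auto
  then have "s < x \<longleftrightarrow> s < y" "s \<le> x \<longleftrightarrow> s \<le> y" if "s \<in> S" for s
    using that by blast+
  then show ?thesis using assms(3) by force
qed

lemma position_eq_if_disjoint:
  assumes "is_interval J" "J \<inter> S = {}" "x \<in> J" "y \<in> J"
  shows "position S x = position S y"
proof -
  have "s < x \<longleftrightarrow> s < y" "s \<le> x \<longleftrightarrow> s \<le> y" if "s \<in> S" for s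
    using mem_is_interval_1_I[OF assms(1,3,4), of s] mem_is_interval_1_I[OF assms(1,4,3), of s]
      that assms by force+
  then have "{s \<in> S. s < x} = {s \<in> S. s < y}" "{s \<in> S. s \<le> x} = {s \<in> S. s \<le> y}" by auto
  then show ?thesis by (simp add: position_def)
qed

text \<open>This is where the two sides of a discontinuity or turning point enter: an interval containing
  a single point of \<open>S\<close> still meets two gaps.\<close>

lemma card_positions_le_2:
  assumes A: "is_interval A" and s: "A \<inter> S \<subseteq> {s}"
  shows "finite (position S ` (A - S))" "card (position S ` (A - S)) \<le> 2"
proof -
  have const: "\<exists>p. position S ` J \<subseteq> {p}" if "is_interval J" "J \<inter> S = {}" for J
  proof (cases "J = {}")
    case False
    then obtain x where x: "x \<in> J" by blast
    have "position S y \<in> {position S x}" if y: "y \<in> J" for y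
      using position_eq_if_disjoint[OF \<open>is_interval J\<close> \<open>J \<inter> S = {}\<close> y x] by simp
    then show ?thesis by blast
  qed simp
  have "is_interval (A \<inter> {..<s})" "is_interval (A \<inter> {s<..})"
    using A by (auto intro!: is_interval_Int)
  moreover have "A \<inter> {..<s} \<inter> S = {}" "A \<inter> {s<..} \<inter> S = {}" using s by auto
  ultimately obtain p q where
    pq: "position S ` (A \<inter> {..<s}) \<subseteq> {p}" "position S ` (A \<inter> {s<..}) \<subseteq> {q}"
    using const by metis
  have "\<exists>p q. position S ` (A - S) \<subseteq> {p, q}"
  proof (cases "s \<in> S")
    case True
    have "A - S \<subseteq> (A \<inter> {..<s}) \<union> (A \<inter> {s<..})"
    proof
      fix x assume "x \<in> A - S"
      with True have "x \<in> A" "x \<noteq> s" by auto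
      then show "x \<in> (A \<inter> {..<s}) \<union> (A \<inter> {s<..})" by (cases x s rule: linorder_cases) auto
    qed
    then have "position S ` (A - S) \<subseteq> {p} \<union> {q}"
      using image_mono[of "A - S" _ "position S"] Un_mono[OF pq] unfolding image_Un[symmetric]
      by (metis order.trans)
    then show ?thesis by auto
  next
    case False
    then have "A \<inter> S = {}" using s by auto
    from const[OF A this] obtain p where "position S ` A \<subseteq> {p}" ..
    then have "position S ` (A - S) \<subseteq> {p, p}" by auto
    then show ?thesis by (intro exI)
  qed
  then obtain p q where sub: "position S ` (A - S) \<subseteq> {p, q}" by blast
  show "finite (position S ` (A - S))" using sub finite_subset by blast
  have "card {p, q} \<le> 2" by (simp add: card_insert_if)
  then show "card (position S ` (A - S)) \<le> 2" using card_mono[OF _ sub] by simp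
qed

section \<open>Generic points\<close>

locale interval_system = cut_map +
  fixes D :: "real set"
  assumes compact_X: "compact X" and interior_X: "interior X \<noteq> {}" and finite_D: "finite D"
begin

lemma mem_X_tilde: "x \<in> X_tilde X g D \<longleftrightarrow> x \<in> X \<and> (\<forall>n. (g ^^ n) x \<notin> D)"
  using iter_in by (auto simp: X_tilde_def preim_def)

text \<open>The iterates have finite fibres, so only countably many orbits ever meet \<open>F \<union> D\<close>.\<close>

lemma generic_point:
  assumes "x \<in> X" "y \<in> X" "x < y"
  obtains z where "x < z" "z < y" "z \<in> X" "\<And>n. (g ^^ n) z \<notin> F \<union> D"
proof -
  let ?bad = "\<Union>n. {z \<in> X. (g ^^ n) z \<in> F \<union> D}"
  have "countable ?bad"
    using finite_iter_preimage[of "F \<union> D"] finite_F finite_D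
    by (intro countable_UN countableI_type countable_finite) auto
  then have unc: "uncountable ({x<..<y} - ?bad)"
    using assms(3) by (intro uncountable_minus_countable) (auto simp: uncountable_open_interval)
  have "{x<..<y} - ?bad \<noteq> {}"
  proof
    assume empty: "{x<..<y} - ?bad = {}"
    from unc show False unfolding empty by simp
  qed
  then obtain z where z: "z \<in> {x<..<y} - ?bad" by blast
  moreover have "z \<in> X" using mem_is_interval_1_I[OF interval assms(1,2), of z] z by auto
  ultimately show ?thesis by (intro that[of z]) auto
qed

lemma endpoints:
  obtains a b where "a < b" "X = {a..b}"
proof -
  have "X \<noteq> {}" using interior_X interior_subset by auto
  moreover have "connected X" using interval by (simp add: is_interval_connected_1)
  ultimately obtain a b where ab: "X = {a..b}"
    using connected_compact_interval_1 compact_X by metis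
  with interior_X have "a < b" by (cases "a < b") (auto simp: interior_atLeastAtMost_real)
  with ab show ?thesis using that by blast
qed

lemma X_tilde_nonempty: "X_tilde X g D \<noteq> {}"
proof -
  obtain a b where ab: "a < b" "X = {a..b}" by (rule endpoints)
  then have "a \<in> X" "b \<in> X" by auto
  then obtain z where "z \<in> X" "\<And>n. (g ^^ n) z \<notin> F \<union> D"
    using generic_point ab(1) by blast
  then show ?thesis using mem_X_tilde by blast
qed

section \<open>Entropy is at most the growth rate of the laps\<close>

text \<open>Cut \<open>X\<close> at all points whose orbit meets, before time \<open>n\<close>, either \<open>F\<close> or a net \<open>T\<close> adapted to the
  cover. On a gap between these cuts the first \<open>n\<close> iterates are continuous, and their images are
  intervals that avoid \<open>T\<close>, so that each of them fits into one set of the cover. Thus one element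
  of \<open>coll_iter X g D C n\<close> suffices for each gap, and one for each cut point.\<close>

lemma small_subcover:
  assumes C: "open_cover X C"
  obtains M :: real where "0 < M"
    "\<And>n. \<exists>E \<subseteq> coll_iter X g D C n. finite E \<and> X_tilde X g D \<subseteq> \<Union>E \<and>
       real (card E) \<le> M * (real n + 1) * real (laps n)"
proof -
  obtain T where T: "finite T"
    "\<And>J. is_interval J \<Longrightarrow> J \<noteq> {} \<Longrightarrow> J \<subseteq> X - T \<Longrightarrow> \<exists>A\<in>C. J \<subseteq> A"
    using open_cover_cuts[OF compact_X C] by metis
  define M where "M = 2 * (real (card T) + 1)"
  have "\<exists>E \<subseteq> coll_iter X g D C n. finite E \<and> X_tilde X g D \<subseteq> \<Union>E \<and>
       real (card E) \<le> M * (real n + 1) * real (laps n)" for n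
  proof -
    define S where "S = cut_set X g F n \<union> cut_set X g T n"
    have S: "finite S" using finite_cut_set cut_set_other(1)[OF T(1)] by (simp add: S_def)
    have cls: "\<exists>A\<in>coll_iter X g D C n. {y \<in> X_tilde X g D. position S y = position S x} \<subseteq> A"
      if x: "x \<in> X_tilde X g D" for x
    proof -
      define K where "K = {y \<in> X_tilde X g D. position S y = position S x}"
      have xK: "x \<in> K" using x by (simp add: K_def)
      have KX: "K \<subseteq> X" using mem_X_tilde by (auto simp: K_def)
      have "\<exists>c\<in>C. (g ^^ j) ` K \<subseteq> c" if j: "j < n" for j
  
    proof (cases "K = {x}")
        case True
        have "(g ^^ j) x \<in> X" using x iter_in mem_X_tilde by blast
        with C True show ?thesis by (auto simp: open_cover_def)
      next
        case False
        \<comment> \<open>\<open>H\<close> is the convex hull of the class \<open>K\<close>. As \<open>K\<close> has more than one point, it lies in a gap.\<close>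
        define H where "H = {z. \<exists>p\<in>K. \<exists>q\<in>K. p < q \<and> p \<le> z \<and> z \<le> q}"
        have KH: "K \<subseteq> H"
        proof
          fix p assume p: "p \<in> K"
          obtain q where q: "q \<in> K" "q \<noteq> p" using False xK by blast
          then consider "p < q" "p \<le> q" | "q < p" "q \<le> p" by linarith
          then show "p \<in> H"
            unfolding H_def using p q(1) order.refl[of p] by cases blast+
        qed
        have H: "is_interval H"
          unfolding is_interval_1
        proof (intro ballI allI impI)
          fix u v z assume "u \<in> H" "v \<in> H" and z: "u \<le> z \<and> z \<le> v"
          then obtain p q p' q' where pq: "p \<in> K" "q \<in> K" "p < q" "p \<le> u" "u \<le> q"
            "p' \<in> K" "q' \<in> K" "p' < q'" "p' \<le> v" "v \<le> q'" unfolding H_def by blast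
          show "z \<in> H"
          proof (cases "z \<le> q")
            case True
            with pq z show ?thesis unfolding H_def by (blast intro: order.trans)
          next
            case False
            with pq z have "p < q'" "p \<le> z" "z \<le> q'" by linarith+
            with pq show ?thesis unfolding H_def by blast
          qed
        qed
        have HX: "H \<subseteq> X - S"
        proof
          fix z assume "z \<in> H"
          then obtain p q where pq: "p \<in> K" "q \<in> K" "p < q" "p \<le> z" "z \<le> q"
            by (auto simp: H_def)
          then have "position S p = position S q" by (simp add: K_def)
          from position_eq_imp_disjoint[OF S this pq(3)] pq have "z \<notin> S" by auto
          moreover have "z \<in> X"
            using mem_is_interval_1_I[OF interval, of p q z] pq KX by blast
          ultimately show "z \<in> X - S" by simp
        qed
        have "continuous_on H (g ^^ j)"
          using iter_between_cuts[OF H, of n j] HX j by (auto simp: S_def)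
        from connected_continuous_image[OF this] H have "is_interval ((g ^^ j) ` H)"
          by (simp add: is_interval_connected_1)
        moreover have "(g ^^ j) ` H \<subseteq> X - T"
        proof
          fix w assume "w \<in> (g ^^ j) ` H"
          then obtain z where z: "z \<in> H" "w = (g ^^ j) z" by blast
          with HX have "z \<in> X" "z \<notin> cut_set X g T n" by (auto simp: S_def)
          with z j show "w \<in> X - T" using iter_in by (auto simp: cut_set_def)
        qed
        moreover have "(g ^^ j) ` H \<noteq> {}" using KH xK by blast
        ultimately obtain c where "c \<in> C" "(g ^^ j) ` H \<subseteq> c" using T(2) by blast
        with KH show ?thesis by blast
      qed
      then obtain c where c: "\<And>j. j < n \<Longrightarrow> c j \<in> C \<and> (g ^^ j) ` K \<subseteq> c j" by metis
      have KA: "K \<subseteq> (\<Inter>j<n. preim X g j (c j - D))"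
      proof (intro INT_greatest subsetI)
        fix j y assume "j \<in> {..<n}" and y: "y \<in> K"
        then have "(g ^^ j) y \<in> c j" using c[of j] by auto
        moreover have "y \<in> X" "(g ^^ j) y \<notin> D" using y mem_X_tilde by (auto simp: K_def)
        ultimately show "y \<in> preim X g j (c j - D)" by (simp add: preim_def)
      qed
      moreover have "(\<Inter>j<n. preim X g j (c j - D)) \<in> coll_iter X g D C n"
        unfolding coll_iter_iff
      proof (intro conjI exI[of _ c])
        show "(\<Inter>j<n. preim X g j (c j - D)) \<noteq> {}" using KA xK by blast
      qed (use c in auto)
      ultimately show ?thesis unfolding K_def by blast
    qed
    have "position S ` X_tilde X g D \<subseteq> {..2 * card S}" using position_le[OF S] by auto
    then obtain E where E: "E \<subseteq> coll_iter X g D C n" "finite E" "X_tilde X g D \<subseteq> \<Union>E"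
      "card E \<le> card {..2 * card S}"
      by (rule finite_subcover_of_classes[OF finite_atMost _ cls]) auto
    have "card S \<le> card (cut_set X g F n) + n * (laps n * (card T + 1))"
      unfolding S_def using card_Un_le cut_set_other(2)[OF T(1)] add_left_mono order.trans by blast
    then have "card E \<le> 2 * laps n + 2 * (n * (laps n * (card T + 1)))"
      using E(4) by (simp add: laps_def)
    then have "real (card E) \<le> real (2 * laps n + 2 * (n * (laps n * (card T + 1))))"
      by (rule of_nat_mono)
    also have "\<dots> \<le> M * (real n + 1) * real (laps n)"
      by (simp add: M_def algebra_simps)
    finally show ?thesis using E by blast
  qed
  moreover have "0 < M" by (simp add: M_def)
  ultimately show ?thesis using that by blast
qed

text \<open>As covers of a compact set have the finite subcovers just constructed, this number is the
  size of an actual subcover.\<close>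

definition cover_count :: "real set set \<Rightarrow> nat \<Rightarrow> nat" where
  "cover_count C n = aleph (X_tilde X g D) (coll_iter X g D C n)"

lemma minimal_subcover:
  assumes "open_cover X C"
  obtains E where "E \<subseteq> coll_iter X g D C n" "finite E" "X_tilde X g D \<subseteq> \<Union>E"
    "card E = cover_count C n"
proof -
  obtain E' where "E' \<subseteq> coll_iter X g D C n" "finite E'" "X_tilde X g D \<subseteq> \<Union>E'"
    using small_subcover[OF assms] by metis
  from aleph_attained[OF this] show ?thesis using that unfolding cover_count_def by blast
qed

lemma cover_count_pos:
  assumes "open_cover X C" shows "1 \<le> cover_count C n"
proof -
  obtain E where E: "finite E" "X_tilde X g D \<subseteq> \<Union>E" "card E = cover_count C n"
    using minimal_subcover[OF assms] by metis
  then have "E \<noteq> {}" using X_tilde_nonempty by auto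
  with E(1) have "0 < card E" using card_gt_0_iff by blast
  with E(3) show ?thesis by simp
qed

text \<open>Intersecting a subcover for time \<open>n\<close> with the pullback under \<open>g ^^ n\<close> of one for time \<open>m\<close>
  gives a subcover for time \<open>n + m\<close>, because \<open>X_tilde\<close> is mapped into itself.\<close>

lemma cover_count_add:
  assumes C: "open_cover X C"
  shows "cover_count C (n + m) \<le> cover_count C n * cover_count C m"
proof (cases "n = 0 \<or> m = 0")
  case True
  then show ?thesis using cover_count_pos[OF C, of 0] by auto
next
  case False
  obtain E where E: "E \<subseteq> coll_iter X g D C n" "finite E" "X_tilde X g D \<subseteq> \<Union>E"
    "card E = cover_count C n" by (rule minimal_subcover[OF C])
  obtain E' where E': "E' \<subseteq> coll_iter X g D C m" "finite E'" "X_tilde X g D \<subseteq> \<Union>E'"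
    "card E' = cover_count C m" by (rule minimal_subcover[OF C])
  \<comment> \<open>Disjoint pairs give the empty set, which is not an element of \<open>coll_iter\<close>.\<close>
  define J where "J = (\<lambda>(A, B). A \<inter> preim X g n B) ` (E \<times> E')"
  have "A \<inter> preim X g n B \<in> coll_iter X g D C (n + m)"
    if A: "A \<in> E" and B: "B \<in> E'" and ne: "A \<inter> preim X g n B \<noteq> {}" for A B
  proof -
    have AB: "A \<in> coll_iter X g D C n" "B \<in> coll_iter X g D C m" using A B E(1) E'(1) by auto
    from AB(1)[unfolded coll_iter_iff] obtain c where
      c: "\<forall>j<n. c j \<in> C" "A = (\<Inter>j<n. preim X g j (c j - D))" by (elim conjE exE) (rule that)
    from AB(2)[unfolded coll_iter_iff] obtain c' where
      c': "\<forall>j<m. c' j \<in> C" "B = (\<Inter>j<m. preim X g j (c' j - D))" by (elim conjE exE) (rule that)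
    define d where "d j = (if j < n then c j else c' (j - n))" for j
    have split: "{..<n + m} = {..<n} \<union> (\<lambda>i. i + n) ` {..<m}"
    proof
      show "{..<n + m} \<subseteq> {..<n} \<union> (\<lambda>i. i + n) ` {..<m}"
      proof
        fix j assume "j \<in> {..<n + m}"
        then show "j \<in> {..<n} \<union> (\<lambda>i. i + n) ` {..<m}"
          by (cases "j < n") (auto intro!: image_eqI[of _ _ "j - n"])
      qed
    qed auto
    have "preim X g n B = (\<Inter>i<m. preim X g (i + n) (c' i - D))"
    proof (rule set_eqI)
      fix x
      have "m \<noteq> 0" using False by simp
      then show "x \<in> preim X g n B \<longleftrightarrow> x \<in> (\<Inter>i<m. preim X g (i + n) (c' i - D))"
        unfolding c'(2) preim_def using iter_in[of x n] by (auto simp: funpow_add)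
    qed
    then have "A \<inter> preim X g n B = (\<Inter>j<n + m. preim X g j (d j - D))"
      unfolding split c(2) by (simp add: d_def INF_union)
    moreover have "\<forall>j<n + m. d j \<in> C" using c(1) c'(1) by (auto simp: d_def)
    ultimately show ?thesis using ne unfolding coll_iter_iff by blast
  qed
  then have sub: "J - {{}} \<subseteq> coll_iter X g D C (n + m)" by (auto simp: J_def)
  have cov: "X_tilde X g D \<subseteq> \<Union>(J - {{}})"
  proof
    fix x assume x: "x \<in> X_tilde X g D"
    have "(g ^^ i) ((g ^^ n) x) \<notin> D" for i
      using x mem_X_tilde by (metis comp_apply funpow_add)
    then have gx: "(g ^^ n) x \<in> X_tilde X g D"
      using x mem_X_tilde iter_in by blast
    obtain A where A: "A \<in> E" "x \<in> A" using x E(3) by blast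
    obtain B where B: "B \<in> E'" "(g ^^ n) x \<in> B" using gx E'(3) by blast
    have "x \<in> A \<inter> preim X g n B" using A B x mem_X_tilde by (simp add: preim_def)
    moreover have "A \<inter> preim X g n B \<in> J" using A B by (auto simp: J_def)
    ultimately show "x \<in> \<Union>(J - {{}})" by blast
  qed
  have finJ: "finite J" using E(2) E'(2) by (simp add: J_def)
  have "cover_count C (n + m) \<le> card (J - {{}})"
    unfolding cover_count_def using aleph_le[OF sub _ cov] finJ by simp
  also have "\<dots> \<le> card J" using finJ by (intro card_mono) auto
  also have "\<dots> \<le> card (E \<times> E')" unfolding J_def using E E' by (intro card_image_le) auto
  finally show ?thesis using E(4) E'(4) by (simp add: card_cartesian_product)
qed

lemma htop_cover_LIMSEQ:
  assumes C: "open_cover X C"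
  shows "(\<lambda>n. ln (real (cover_count C n)) / real n) \<longlonglongrightarrow> htop_cover X g D C"
proof -
  have pos: "0 < real (cover_count C n)" for n
    using cover_count_pos[OF C, of n] by simp
  have "convergent (\<lambda>n. ln (real (cover_count C n)) / real n)"
  proof (rule fekete)
    fix m n
    have "real (cover_count C (m + n)) \<le> real (cover_count C m) * real (cover_count C n)"
      using cover_count_add[OF C, of m n] by (metis of_nat_le_iff of_nat_mult)
    then have "ln (real (cover_count C (m + n))) \<le> ln (real (cover_count C m) * real (cover_count C n))"
      using pos by (subst ln_le_cancel_iff) auto
    then show "ln (real (cover_count C (m + n))) \<le> ln (real (cover_count C m)) + ln (real (cover_count C n))"
      using pos by (simp add: ln_mult)
  qed (use cover_count_pos[OF C] in \<open>auto intro!: ln_ge_zero\<close>)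
  then show ?thesis
    unfolding htop_cover_def cover_count_def[symmetric] by (simp add: convergent_LIMSEQ_iff)
qed

end

context cut_map
begin

definition lap_growth :: real where
  "lap_growth = lim (\<lambda>n. ln (real (laps n)) / real n)"

lemma laps_pos: "0 < real (laps n)" by (simp add: laps_def)

lemma lap_growth_LIMSEQ: "(\<lambda>n. ln (real (laps n)) / real n) \<longlonglongrightarrow> lap_growth"
proof -
  have "convergent (\<lambda>n. ln (real (laps n)) / real n)"
  proof (rule fekete)
    fix m n
    have "real (laps (m + n)) \<le> real (laps m) * real (laps n)"
      using laps_add[of m n] by (metis of_nat_le_iff of_nat_mult)
    then have "ln (real (laps (m + n))) \<le> ln (real (laps m) * real (laps n))"
      using laps_pos by (subst ln_le_cancel_iff) auto
    then show "ln (real (laps (m + n))) \<le> ln (real (laps m)) + ln (real (laps n))"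
      using laps_pos by (simp add: ln_mult)
  qed (auto simp: laps_def intro!: ln_ge_zero)
  then show ?thesis
    unfolding lap_growth_def by (simp add: convergent_LIMSEQ_iff)
qed

lemma lap_growth_LIMSEQ_multiples:
  assumes "0 < k"
  shows "(\<lambda>m. ln (real (laps (k * m))) / real (k * m)) \<longlonglongrightarrow> lap_growth"
proof -
  have "strict_mono (\<lambda>m. k * m)" using assms by (simp add: strict_mono_def)
  from LIMSEQ_subseq_LIMSEQ[OF lap_growth_LIMSEQ this] show ?thesis by (simp add: comp_def)
qed

end

lemma (in interval_system) htop_cover_le_lap_growth:
  assumes C: "open_cover X C"
  shows "htop_cover X g D C \<le> lap_growth"
proof -
  obtain M :: real where M: "0 < M"
    "\<And>n. \<exists>E \<subseteq> coll_iter X g D C n. finite E \<and> X_tilde X g D \<subseteq> \<Union>E \<and>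
       real (card E) \<le> M * (real n + 1) * real (laps n)"
    using small_subcover[OF C] by metis
  have le: "ln (real (cover_count C n)) / real n
      \<le> (ln M + ln (real n + 1)) / real n + ln (real (laps n)) / real n" for n
  proof -
    have "real (cover_count C n) \<le> M * (real n + 1) * real (laps n)"
      using M(2)[of n] aleph_le[of _ "coll_iter X g D C n" "X_tilde X g D"]
      unfolding cover_count_def by (meson of_nat_mono order.trans)
    moreover have "0 < real (cover_count C n)" using cover_count_pos[OF C, of n] by simp
    ultimately have "ln (real (cover_count C n)) \<le> ln (M * (real n + 1) * real (laps n))"
      by simp
    also have "\<dots> = (ln M + ln (real n + 1)) + ln (real (laps n))"
      using M(1) laps_pos[of n] by (simp add: ln_mult)
    finally show ?thesis
      unfolding add_divide_distrib[symmetric] by (rule divide_right_mono) simp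
  qed
  have "(\<lambda>n. (ln M + ln (real n + 1)) / real n) \<longlonglongrightarrow> 0" by real_asymp
  from tendsto_add[OF this lap_growth_LIMSEQ]
  have "(\<lambda>n. (ln M + ln (real n + 1)) / real n + ln (real (laps n)) / real n) \<longlonglongrightarrow> lap_growth"
    by simp
  from LIMSEQ_le[OF htop_cover_LIMSEQ[OF C] this] le show ?thesis by blast
qed

section \<open>Entropy is at least the growth rate of the laps\<close>

text \<open>The itinerary of a point is read off only at the times \<open>0, k, 2 k, \<dots>\<close>, relative to the cuts of
  \<open>g ^^ k\<close>. As long as no cut lies between \<open>x\<close> and \<open>y\<close>, the iterate \<open>g ^^ (k * m)\<close> is monotone on
  \<open>{x..y}\<close>. Hence it maps \<open>{x..y}\<close> between the images of the endpoints, and equal positions of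
  these images exclude a cut there.\<close>

lemma (in cut_map) same_itinerary_no_cut:
  fixes k :: nat
  defines "S \<equiv> cut_set X g F k"
  assumes xy: "x \<in> X" "y \<in> X" "x < y"
    and generic: "\<And>n. (g ^^ n) x \<notin> F" "\<And>n. (g ^^ n) y \<notin> F"
    and same: "\<And>i. i < m \<Longrightarrow> position S ((g ^^ (k * i)) x) = position S ((g ^^ (k * i)) y)"
  shows "{x..y} \<inter> cut_set X g F (k * m) = {}"
  using same
proof (induction m)
  case 0 show ?case by (simp add: cut_set_def)
next
  case (Suc m)
  define h where "h = g ^^ (k * m)"
  have IH: "{x..y} \<inter> cut_set X g F (k * m) = {}" using Suc by simp
  have sub: "{x..y} \<subseteq> X" using mem_is_interval_1_I[OF interval xy(1,2)] by auto
  have S: "finite S" unfolding S_def by (rule finite_cut_set)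
  have h: "continuous_on {x..y} h" "inj_on h {x..y}"
    using iter_between_cuts[of "{x..y}" "k * m" "k * m"] IH sub by (auto simp: h_def)
  have eq: "position S (h x) = position S (h y)"
    unfolding h_def by (rule Suc.prems) simp
  have ends: "h x \<notin> S" "h y \<notin> S"
    unfolding S_def h_def cut_set_def using generic by (auto simp flip: funpow_add[THEN fun_cong, unfolded comp_apply])
  have "h z \<notin> S" if z: "z \<in> {x..y}" for z
  proof (cases "z = x \<or> z = y")
    case True with ends show ?thesis by auto
  next
    case False
    with z have "x < z" "z < y" by auto
    from continuous_inj_imp_mono[OF this h]
    show ?thesis
    proof
      assume b: "h x < h z \<and> h z < h y"
      then have "h x < h y" by simp
      from position_eq_imp_disjoint[OF S eq this] b show ?thesis by auto
    next
      assume b: "h y < h z \<and> h z < h x"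
      then have "h y < h x" by simp
      from position_eq_imp_disjoint[OF S eq[symmetric] this] b show ?thesis by auto
    qed
  qed
  then have "{x..y} \<inter> {z \<in> X. h z \<in> S} = {}" by blast
  moreover have "cut_set X g F (k * Suc m) = cut_set X g F (k * m) \<union> {z \<in> X. h z \<in> S}"
    using cut_set_add[of "k * m" k] by (simp add: h_def S_def add.commute)
  ultimately show ?case using IH by blast
qed

context interval_system
begin

text \<open>Each gap between neighbouring points of \<open>S\<close> contains a point whose orbit avoids \<open>F \<union> D\<close>,
  and such points from different gaps have different values under \<open>\<theta>\<close>.\<close>

lemma card_cut_set_le_itineraries:
  fixes \<theta> :: "real \<Rightarrow> 'b"
  assumes fin: "finite (\<theta> ` {x \<in> X. \<forall>n. (g ^^ n) x \<notin> F \<union> D})" and S: "finite S" "S \<subseteq> X"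
    and sep: "\<And>x y. x \<in> X \<Longrightarrow> y \<in> X \<Longrightarrow> x < y \<Longrightarrow> \<forall>n. (g ^^ n) x \<notin> F \<union> D \<Longrightarrow>
      \<forall>n. (g ^^ n) y \<notin> F \<union> D \<Longrightarrow> \<theta> x = \<theta> y \<Longrightarrow> {x..y} \<inter> S = {}"
  shows "card S \<le> card (\<theta> ` {x \<in> X. \<forall>n. (g ^^ n) x \<notin> F \<union> D}) + 1"
proof -
  let ?Y = "{x \<in> X. \<forall>n. (g ^^ n) x \<notin> F \<union> D}"
  obtain a b where ab: "a < b" "X = {a..b}" by (rule endpoints)
  have ex: "\<exists>y. y \<in> ?Y \<and> s < y \<and> (\<forall>s'\<in>S. s < s' \<longrightarrow> y < s')" if s: "s \<in> S - {b}" for s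
  proof -
    \<comment> \<open>\<open>e\<close> is the right neighbour of \<open>s\<close>, or \<open>b\<close>.\<close>
    define e where "e = Min ({s' \<in> S. s < s'} \<union> {b})"
    have "s < b" using s S(2) ab by force
    then have e: "s < e" "e \<le> b" "\<And>s'. s' \<in> S \<Longrightarrow> s < s' \<Longrightarrow> e \<le> s'"
      using S(1) by (auto simp: e_def)
    have "s \<in> X" "e \<in> X" using s S(2) ab e by auto
    then obtain y where y: "s < y" "y < e" "y \<in> X" "\<And>n. (g ^^ n) y \<notin> F \<union> D"
      using generic_point e(1) by blast
    then show ?thesis using e(3) by (intro exI[of _ y]) force
  qed
  have "\<exists>y. \<forall>s\<in>S - {b}. y s \<in> ?Y \<and> s < y s \<and> (\<forall>s'\<in>S. s < s' \<longrightarrow> y s < s')"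
    by (intro bchoice ballI ex)
  then obtain y where
    "\<forall>s\<in>S - {b}. y s \<in> ?Y \<and> s < y s \<and> (\<forall>s'\<in>S. s < s' \<longrightarrow> y s < s')" ..
  note y = bspec[OF this]
  have "inj_on (\<lambda>s. \<theta> (y s)) (S - {b})"
  proof (rule linorder_inj_onI')
    fix s s' assume s: "s \<in> S - {b}" and s': "s' \<in> S - {b}" and less: "s < s'"
    have 1: "y s < s'" "s' < y s'" using y[OF s] y[OF s'] less s' by auto
    have "s' \<in> {y s..y s'} \<inter> S" using 1 s' by auto
    then have meet: "{y s..y s'} \<inter> S \<noteq> {}" by blast
    have "y s < y s'" using 1 by linarith
    with meet show "\<theta> (y s) \<noteq> \<theta> (y s')"
      using sep[of "y s" "y s'"] y[OF s] y[OF s'] by blast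
  qed
  moreover have "(\<lambda>s. \<theta> (y s)) ` (S - {b}) \<subseteq> \<theta> ` ?Y" using y by blast
  ultimately have "card (S - {b}) \<le> card (\<theta> ` ?Y)" using card_inj_on_le fin by blast
  moreover have "card S \<le> card (S - {b}) + 1"
    using S(1) by (cases "b \<in> S") (auto simp: card_Diff_singleton)
  ultimately show ?thesis by linarith
qed

text \<open>A set of the cover meets at most two gaps of the cuts of \<open>g ^^ k\<close>. Hence the generic points in an
  element of \<open>coll_iter X g D C (k * m)\<close> have at most \<open>2 ^ m\<close> itineraries, one factor \<open>2\<close> for each
  block of \<open>k\<close> iterations, whereas all generic points together have at least as many itineraries
  as there are gaps. The factor \<open>3\<close> absorbs the difference of \<open>2\<close> between the numbers of gaps and laps.\<close>

lemma laps_le_cover_count: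
  assumes k: "0 < k" and C: "open_cover X C"
    and small: "\<And>A. A \<in> C \<Longrightarrow> is_interval A \<and> (\<exists>s. A \<inter> cut_set X g F k \<subseteq> {s})"
  shows "laps (k * m) \<le> 3 * 2 ^ m * cover_count C (k * m)"
proof -
  define S where "S = cut_set X g F k"
  define Y where "Y = {x \<in> X. \<forall>n. (g ^^ n) x \<notin> F \<union> D}"
  define \<theta> where "\<theta> x = restrict (\<lambda>i. position S ((g ^^ (k * i)) x)) {..<m}" for x
  obtain E where E: "E \<subseteq> coll_iter X g D C (k * m)" "finite E" "X_tilde X g D \<subseteq> \<Union>E"
    "card E = cover_count C (k * m)" by (rule minimal_subcover[OF C])
  have words: "finite (\<theta> ` (Y \<inter> A)) \<and> card (\<theta> ` (Y \<inter> A)) \<le> 2 ^ m" if A: "A \<in> E" for A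
  proof -
    have "A \<in> coll_iter X g D C (k * m)" using A E(1) by blast
    from this[unfolded coll_iter_iff] obtain c where
      c: "\<forall>j<k * m. c j \<in> C" "A = (\<Inter>j<k * m. preim X g j (c j - D))"
      by (elim conjE exE) (rule that)
    define W where "W i = position S ` (c (k * i) - S)" for i
    have W: "finite (W i)" "card (W i) \<le> 2" if i: "i < m" for i
    proof -
      have "c (k * i) \<in> C" using c(1) k i by simp
      from small[OF this] obtain s where "is_interval (c (k * i))" "c (k * i) \<inter> S \<subseteq> {s}"
        by (auto simp: S_def)
      from card_positions_le_2[OF this] show "finite (W i)" "card (W i) \<le> 2"
        unfolding W_def by auto
    qed
    have sub: "\<theta> ` (Y \<inter> A) \<subseteq> PiE {..<m} W"
    proof
      fix w assume "w \<in> \<theta> ` (Y \<inter> A)"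
      then obtain x where x: "x \<in> Y" "x \<in> A" "w = \<theta> x" by blast
      have "position S ((g ^^ (k * i)) x) \<in> W i" if i: "i < m" for i
      proof -
        have "k * i < k * m" using k i by simp
        with x(2) c(2) have "(g ^^ (k * i)) x \<in> c (k * i)" by (auto simp: preim_def)
        moreover have "(g ^^ (k * i)) x \<notin> S"
        proof
          assume "(g ^^ (k * i)) x \<in> S"
          then obtain j where "(g ^^ j) ((g ^^ (k * i)) x) \<in> F" by (auto simp: S_def cut_set_def)
          then have "(g ^^ (j + k * i)) x \<in> F" by (simp add: funpow_add)
          then show False using x(1) by (auto simp: Y_def)
        qed
        ultimately show ?thesis unfolding W_def by blast
      qed
      then show "w \<in> PiE {..<m} W" unfolding x(3) \<theta>_def by auto
    qed
    have finP: "finite (PiE {..<m} W)" using W by (intro finite_PiE) auto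
    have "card (PiE {..<m} W) = (\<Prod>i<m. card (W i))" by (simp add: card_PiE)
    also have "\<dots> \<le> (\<Prod>i<m. 2)" using W by (intro prod_mono) auto
    finally have "card (PiE {..<m} W) \<le> 2 ^ m" by simp
    with card_mono[OF finP sub] finite_subset[OF sub finP] show ?thesis by simp
  qed
  have "Y \<subseteq> X_tilde X g D" using mem_X_tilde by (auto simp: Y_def)
  with E(3) have eq: "\<theta> ` Y = (\<Union>A\<in>E. \<theta> ` (Y \<inter> A))" by blast
  have fin: "finite (\<theta> ` Y)" unfolding eq using E(2) words by blast
  have "card (\<theta> ` Y) \<le> (\<Sum>A\<in>E. card (\<theta> ` (Y \<inter> A)))"
    unfolding eq by (rule card_UN_le[OF E(2)])
  also have "\<dots> \<le> (\<Sum>A\<in>E. 2 ^ m)" using words by (intro sum_mono) auto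
  finally have words_Y: "card (\<theta> ` Y) \<le> 2 ^ m * cover_count C (k * m)"
    by (simp add: E(4) mult.commute)
  have "card (cut_set X g F (k * m)) \<le> card (\<theta> ` Y) + 1"
    unfolding Y_def
  proof (rule card_cut_set_le_itineraries)
    show "finite (\<theta> ` {x \<in> X. \<forall>n. (g ^^ n) x \<notin> F \<union> D})" using fin unfolding Y_def .
    fix x y assume xy: "x \<in> X" "y \<in> X" "x < y" and gen: "\<forall>n. (g ^^ n) x \<notin> F \<union> D"
      "\<forall>n. (g ^^ n) y \<notin> F \<union> D" and eq: "\<theta> x = \<theta> y"
    show "{x..y} \<inter> cut_set X g F (k * m) = {}"
    proof (rule same_itinerary_no_cut[OF xy])
      fix i assume "i < m"
      with fun_cong[OF eq, of i]
      show "position (cut_set X g F k) ((g ^^ (k * i)) x) = position (cut_set X g F k) ((g ^^ (k * i)) y)"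
        by (simp add: \<theta>_def S_def)
    qed (use gen in auto)
  qed (use finite_cut_set in \<open>auto simp: cut_set_def\<close>)
  moreover have "1 \<le> 2 ^ m * cover_count C (k * m)"
    using cover_count_pos[OF C, of "k * m"] by simp
  ultimately show ?thesis using words_Y unfolding laps_def by linarith
qed

lemma fine_cover:
  assumes S: "finite S"
  obtains C where "open_cover X C" "\<And>A. A \<in> C \<Longrightarrow> is_interval A \<and> (\<exists>s. A \<inter> S \<subseteq> {s})"
proof
  let ?C = "{A. A \<noteq> {} \<and> openin (top_of_set X) A \<and> is_interval A \<and> (\<exists>s. A \<inter> S \<subseteq> {s})}"
  show "is_interval A \<and> (\<exists>s. A \<inter> S \<subseteq> {s})" if "A \<in> ?C" for A using that by blast
  have "x \<in> \<Union>?C" if x: "x \<in> X" for x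
  proof -
    obtain d where d: "0 < d" "\<forall>s\<in>S. s \<noteq> x \<longrightarrow> d \<le> dist x s"
      using finite_set_avoid[OF S] by blast
    have "X \<inter> ball x d \<in> ?C"
    proof (intro CollectI conjI exI)
      show "X \<inter> ball x d \<noteq> {}" using x d(1) by auto
      show "openin (top_of_set X) (X \<inter> ball x d)" by (intro openin_open_Int) simp
      show "is_interval (X \<inter> ball x d)"
        using interval by (intro is_interval_Int) (auto simp: is_interval_ball_real)
      show "X \<inter> ball x d \<inter> S \<subseteq> {x}" using d(2) by force
    qed
    moreover have "x \<in> X \<inter> ball x d" using x d(1) by simp
    ultimately show ?thesis by (rule UnionI)
  qed
  then show "open_cover X ?C" unfolding open_cover_def by blast
qed

text \<open>The error \<open>ln 2 / k\<close> is the price of one factor \<open>2\<close> per \<open>k\<close> iterations. It is made small by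
  letting the cover depend on \<open>k\<close>.\<close>

lemma lap_growth_le_htop_cover:
  assumes k: "0 < k"
  obtains C where "open_cover X C" "lap_growth \<le> htop_cover X g D C + ln 2 / real k"
proof -
  obtain C where C: "open_cover X C"
    and small: "\<And>A. A \<in> C \<Longrightarrow> is_interval A \<and> (\<exists>s. A \<inter> cut_set X g F k \<subseteq> {s})"
    using fine_cover[OF finite_cut_set[of k]] by metis
  have le: "ln (real (laps (k * m))) / real (k * m) \<le>
      (ln 3 + real m * ln 2) / (real k * real m) + ln (real (cover_count C (k * m))) / real (k * m)"
    for m
  proof -
    have pos: "0 < real (cover_count C (k * m))" using cover_count_pos[OF C, of "k * m"] by simp
    have "real (laps (k * m)) \<le> real (3 * 2 ^ m * cover_count C (k * m))"
      using laps_le_cover_count[OF k C small] by (rule of_nat_mono)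
    then have "ln (real (laps (k * m))) \<le> ln (3 * 2 ^ m * real (cover_count C (k * m)))"
      using laps_pos by (subst ln_le_cancel_iff) (use pos in auto)
    also have "\<dots> = (ln 3 + real m * ln 2) + ln (real (cover_count C (k * m)))"
      using pos by (simp add: ln_mult ln_realpow)
    finally have "ln (real (laps (k * m))) / real (k * m) \<le>
      ((ln 3 + real m * ln 2) + ln (real (cover_count C (k * m)))) / real (k * m)"
      by (rule divide_right_mono) simp
    then show ?thesis by (simp add: add_divide_distrib)
  qed
  have k': "0 < real k" using k by simp
  have "(\<lambda>m. (ln 3 + real m * ln 2) / (real k * real m)) \<longlonglongrightarrow> ln 2 * inverse (real k)"
    using k' by real_asymp
  then have "(\<lambda>m. (ln 3 + real m * ln 2) / (real k * real m)) \<longlonglongrightarrow> ln 2 / real k"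
    by (simp only: divide_inverse[of "ln (2::real)"])
  moreover have "strict_mono (\<lambda>m. k * m)" using k by (simp add: strict_mono_def)
  from LIMSEQ_subseq_LIMSEQ[OF htop_cover_LIMSEQ[OF C] this]
  have "(\<lambda>m. ln (real (cover_count C (k * m))) / real (k * m)) \<longlonglongrightarrow> htop_cover X g D C"
    by (simp add: comp_def)
  ultimately have "(\<lambda>m. (ln 3 + real m * ln 2) / (real k * real m) +
      ln (real (cover_count C (k * m))) / real (k * m)) \<longlonglongrightarrow> ln 2 / real k + htop_cover X g D C"
    by (rule tendsto_add)
  from LIMSEQ_le[OF lap_growth_LIMSEQ_multiples[OF k] this] le
  have "lap_growth \<le> ln 2 / real k + htop_cover X g D C" by blast
  with C show ?thesis by (intro that) auto
qed

theorem htop_eq_lap_growth: "htop X g D = ereal lap_growth"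
proof (rule antisym)
  show "htop X g D \<le> ereal lap_growth"
    unfolding htop_def using htop_cover_le_lap_growth by (intro SUP_least) auto
  have le: "ereal (lap_growth - ln 2 / real k) \<le> htop X g D" if k: "0 < k" for k
  proof -
    obtain C where C: "open_cover X C" "lap_growth \<le> htop_cover X g D C + ln 2 / real k"
      by (rule lap_growth_le_htop_cover[OF k])
    have "ereal (lap_growth - ln 2 / real k) \<le> ereal (htop_cover X g D C)" using C(2) by simp
    also have "\<dots> \<le> htop X g D" unfolding htop_def using C(1) by (intro SUP_upper) simp
    finally show ?thesis .
  qed
  have "(\<lambda>k. c - ln 2 / real k) \<longlonglongrightarrow> c" for c :: real by real_asymp
  then have lim: "(\<lambda>k. ereal (lap_growth - ln 2 / real k)) \<longlonglongrightarrow> ereal lap_growth"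
    unfolding lim_ereal .
  show "ereal lap_growth \<le> htop X g D"
    by (rule LIMSEQ_le_const2[OF lim]) (use le in \<open>auto intro!: exI[of _ 1]\<close>)
qed

end

section \<open>Monotone partitions and the growth rate of the laps\<close>

lemma interval_minus_interior:
  fixes P :: "real set"
  assumes "is_interval P" "bounded P"
  shows "closure P - interior P \<subseteq> {Inf P, Sup P}"
proof (cases "P = {}")
  case False
  have bdd: "bdd_below P" "bdd_above P"
    using assms(2) by (auto simp: bounded_imp_bdd_below bounded_imp_bdd_above)
  have "P \<subseteq> {Inf P..Sup P}" using bdd by (auto intro: cInf_lower cSup_upper)
  then have cl: "closure P \<subseteq> {Inf P..Sup P}" by (rule closure_minimal) simp
  have "{Inf P<..<Sup P} \<subseteq> P"
  proof
    fix x assume x: "x \<in> {Inf P<..<Sup P}"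
    obtain u where u: "u \<in> P" "u < x" using x False bdd cInf_less_iff[of P x] by auto
    obtain v where v: "v \<in> P" "x < v" using x False bdd less_cSup_iff[of P x] by auto
    show "x \<in> P" by (rule mem_is_interval_1_I[OF assms(1) u(1) v(1)]) (use u v in auto)
  qed
  then have "{Inf P<..<Sup P} \<subseteq> interior P" by (simp add: interior_maximal)
  with cl show ?thesis by force
qed simp

context interval_system
begin

text \<open>Cut \<open>X = {a..b}\<close> at the cut points inside \<open>{a<..<b}\<close> and let each piece contain its left
  endpoint. The last piece also contains \<open>b\<close>.\<close>

lemma partition_at_cuts:
  obtains \<P> where "\<P> \<in> Phi X (g ^^ k)" "finite \<P>" "card \<P> \<le> laps k"
proof -
  obtain a b where ab: "a < b" "X = {a..b}" by (rule endpoints)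
  define B where "B = insert a (cut_set X g F k \<inter> {a<..<b})"
  define piece where "piece s = {x \<in> X. s \<le> x \<and> (\<forall>e\<in>B. s < e \<longrightarrow> x < e)}" for s
  have B: "finite B" "B \<subseteq> {a..<b}" "a \<in> B" using finite_cut_set ab by (auto simp: B_def)
  have piece_X: "piece s \<subseteq> X" for s by (auto simp: piece_def)
  have self: "s \<in> piece s" if "s \<in> B" for s using that B(2) ab(2) by (auto simp: piece_def)
  have int: "is_interval (piece s)" for s
    unfolding is_interval_1
  proof (intro ballI allI impI)
    fix u v x assume u: "u \<in> piece s" and v: "v \<in> piece s" and x: "u \<le> x \<and> x \<le> v"
    have "x \<in> X" using mem_is_interval_1_I[OF interval, of u v x] u v x piece_X by blast
    moreover have "s \<le> x" using u x by (auto simp: piece_def)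
    moreover have "x < e" if "e \<in> B" "s < e" for e
    proof -
      have "v < e" using v that by (auto simp: piece_def)
      with x show ?thesis by simp
    qed
    ultimately show "x \<in> piece s" by (auto simp: piece_def)
  qed
  have inter: "interior (piece s) \<noteq> {}" if s: "s \<in> B" for s
  proof -
    \<comment> \<open>\<open>t\<close> is the next cut point, or \<open>b\<close>.\<close>
    define t where "t = Min (insert b {e \<in> B. s < e})"
    have t: "s < t" "t \<le> b" "\<And>e. e \<in> B \<Longrightarrow> s < e \<Longrightarrow> t \<le> e"
      using B(1,2) s by (auto simp: t_def)
    have "{s<..<t} \<subseteq> piece s"
    proof
      fix x assume x: "x \<in> {s<..<t}"
      have "a \<le> s" using s B(2) by auto
      with x t(2) have "x \<in> X" unfolding ab(2) by auto
      moreover have "x < e" if "e \<in> B" "s < e" for e using t(3)[OF that] x by simp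
      ultimately show "x \<in> piece s" using x by (auto simp: piece_def)
    qed
    then have "{s<..<t} \<subseteq> interior (piece s)" by (simp add: interior_maximal)
    moreover have "(s + t) / 2 \<in> {s<..<t}" using t(1) by simp
    ultimately show ?thesis by blast
  qed
  have int_X: "interior (piece s) \<subseteq> X - cut_set X g F k" if s: "s \<in> B" for s
  proof
    fix x assume x: "x \<in> interior (piece s)"
    then obtain e where e: "0 < e" "cball x e \<subseteq> piece s" by (auto simp: mem_interior_cball)
    then have l: "x - e \<in> piece s" and r: "x + e \<in> piece s" by (auto simp: dist_real_def subset_iff)
    have bounds: "a < x" "x < b" "s < x"
      using l r e(1) ab(2) by (auto simp: piece_def)
    have xp: "x \<in> piece s" using x interior_subset by blast
    have "x \<notin> cut_set X g F k"
    proof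
      assume "x \<in> cut_set X g F k"
      then have "x \<in> B" using bounds by (simp add: B_def)
      with xp bounds(3) have "x < x" unfolding piece_def by blast
      then show False by simp
    qed
    with xp piece_X show "x \<in> X - cut_set X g F k" by blast
  qed
  have part: "partition_on X (piece ` B)"
  proof (rule partition_onI)
    show "\<Union>(piece ` B) = X"
    proof (intro equalityI subsetI)
      fix x assume x: "x \<in> X"
      define s where "s = Max {e \<in> B. e \<le> x}"
      have fin: "finite {e \<in> B. e \<le> x}" using B(1) by simp
      have "a \<in> {e \<in> B. e \<le> x}" using x ab(2) B(3) by simp
      then have s: "s \<in> {e \<in> B. e \<le> x}" unfolding s_def using Max_in[OF fin] by blast
      have "x < e" if "e \<in> B" "s < e" for e
      proof (rule ccontr)
        assume "\<not> x < e"
        then have "e \<le> s" unfolding s_def using fin that by (intro Max_ge) auto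
        with that show False by simp
      qed
      with s x have "x \<in> piece s" by (auto simp: piece_def)
      with s show "x \<in> \<Union>(piece ` B)" by blast
    qed (use piece_X in blast)
    show "disjnt p q" if p: "p \<in> piece ` B" and q: "q \<in> piece ` B" and "p \<noteq> q" for p q
    proof -
      obtain s t where st: "s \<in> B" "t \<in> B" "p = piece s" "q = piece t" using p q by blast
      with \<open>p \<noteq> q\<close> have "s \<noteq> t" by auto
      have "x \<notin> piece u \<or> x \<notin> piece v" if "u \<in> B" "v \<in> B" "u < v" for u v x
        using that by (auto simp: piece_def)
      with \<open>s \<noteq> t\<close> st show ?thesis by (cases s t rule: linorder_cases) (auto simp: disjnt_iff)
    qed
    show "{} \<notin> piece ` B" using self by blast
  qed
  have "piece ` B \<in> Phi X (g ^^ k)"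
    unfolding Phi_def
  proof (intro CollectI conjI ballI part)
    fix P assume "P \<in> piece ` B"
    then obtain s where s: "s \<in> B" "P = piece s" by blast
    show "is_interval P" "interior P \<noteq> {}" using s int inter by auto
    have I: "is_interval (interior P)"
      using int[of s] s by (simp add: is_interval_convex_1 convex_interior)
    from iter_between_cuts[OF I, of k k] int_X[OF s(1)] s(2)
    have c: "continuous_on (interior P) (g ^^ k)" and i: "inj_on (g ^^ k) (interior P)" by auto
    have "strict_mono_on (interior P) (g ^^ k) \<or> strict_antimono_on (interior P) (g ^^ k)"
      using injective_eq_monotone_map[OF I c] i by blast
    then show "mono_on (interior P) (g ^^ k) \<or> antimono_on (interior P) (g ^^ k)"
      using strict_mono_iff_mono strict_antimono_iff_antimono by blast
    fix x assume "x \<in> interior P"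
    then have "continuous (at x) (g ^^ k)" using c continuous_on_interior by (metis interior_interior)
    then show "continuous (at x within X) (g ^^ k) \<or> removable_discontinuity X (g ^^ k) x"
      using continuous_at_imp_continuous_at_within by blast
  qed
  moreover have "card (piece ` B) \<le> laps k"
  proof -
    have "card (piece ` B) \<le> card B" using B(1) by (rule card_image_le)
    also have "\<dots> \<le> Suc (card (cut_set X g F k \<inter> {a<..<b}))"
      unfolding B_def using finite_cut_set by (simp add: card_insert_if)
    also have "\<dots> \<le> laps k"
      unfolding laps_def using finite_cut_set by (simp add: card_mono)
    finally show ?thesis .
  qed
  ultimately show ?thesis using that B(1) by blast
qed

text \<open>A removable discontinuity of a monotone function is none: the value is squeezed between the
  two one-sided limits, which agree. And monotonicity is strict, since a constant piece would give
  an infinite fibre of \<open>g ^^ k\<close>.\<close>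

lemma not_critical_in_lap:
  assumes P: "\<P> \<in> Phi X (g ^^ k)" "P \<in> \<P>" and x: "x \<in> interior P"
  shows "\<not> critical_point X (g ^^ k) x"
proof -
  let ?h = "g ^^ k"
  have PX: "P \<subseteq> X" using P by (auto simp: Phi_def partition_on_def)
  have intP: "is_interval P" and mono: "mono_on (interior P) ?h \<or> antimono_on (interior P) ?h"
    and lim: "continuous (at x within X) ?h \<or> removable_discontinuity X ?h x"
    using P x by (auto simp: Phi_def)
  have I: "is_interval (interior P)"
    using intP by (simp add: is_interval_convex_1 convex_interior)
  have xX: "x \<in> interior X" using x PX interior_mono by blast
  have at: "at x within X = at x" using xX by (rule at_within_interior)
  obtain l where l: "(?h \<longlongrightarrow> l) (at x)"
    using lim unfolding removable_discontinuity_def continuous_within at by blast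
  obtain e where e: "0 < e" "ball x e \<subseteq> interior P"
    using x open_interior open_contains_ball by blast
  have inP: "t \<in> interior P" if "\<bar>t - x\<bar> < e" for t
    using that e(2) by (auto simp: dist_real_def subset_iff abs_minus_commute)
  have left: "(?h \<longlongrightarrow> l) (at_left x)" and right: "(?h \<longlongrightarrow> l) (at_right x)"
    using l by (auto simp: filterlim_at_split)
  have evl: "\<forall>\<^sub>F t in at_left x. t \<in> interior P \<and> t \<le> x"
    unfolding eventually_at using e(1) inP by (intro exI[of _ e]) (auto simp: dist_real_def)
  have evr: "\<forall>\<^sub>F t in at_right x. t \<in> interior P \<and> x \<le> t"
    unfolding eventually_at using e(1) inP by (intro exI[of _ e]) (auto simp: dist_real_def)
  have "l = ?h x"
    using mono
  proof
    assume m: "mono_on (interior P) ?h"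
    have "l \<le> ?h x"
      using evl by (intro tendsto_upperbound[OF left]) (auto elim!: eventually_mono intro: mono_onD[OF m] x)
    moreover have "?h x \<le> l"
      using evr by (intro tendsto_lowerbound[OF right]) (auto elim!: eventually_mono intro: mono_onD[OF m] x)
    ultimately show ?thesis by simp
  next
    assume m: "antimono_on (interior P) ?h"
    have "?h x \<le> l"
      using evl by (intro tendsto_lowerbound[OF left]) (auto elim!: eventually_mono intro: monotone_onD[OF m] x)
    moreover have "l \<le> ?h x"
      using evr by (intro tendsto_upperbound[OF right]) (auto elim!: eventually_mono intro: monotone_onD[OF m] x)
    ultimately show ?thesis by simp
  qed
  with l have "continuous (at x within X) ?h" unfolding continuous_within at by simp
  moreover have "inj_on ?h (interior P)"
  proof (rule linorder_inj_onI')
    fix u v assume uv: "u \<in> interior P" "v \<in> interior P" "u < v"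
    show "?h u \<noteq> ?h v"
    proof
      assume eq: "?h u = ?h v"
      have sub: "{u..v} \<subseteq> interior P" using mem_is_interval_1_I[OF I uv(1,2)] by auto
      have "?h t \<in> {?h u}" if t: "t \<in> {u..v}" for t
        using mono
      proof
        assume m: "mono_on (interior P) ?h"
        show ?thesis
          using mono_onD[OF m, of u t] mono_onD[OF m, of t v] t sub uv eq by auto
      next
        assume m: "antimono_on (interior P) ?h"
        show ?thesis
          using monotone_onD[OF m, of u t] monotone_onD[OF m, of t v] t sub uv eq by auto
      qed
      then have "{u..v} \<subseteq> {t \<in> X. ?h t \<in> {?h u}}" using sub PX interior_subset by blast
      moreover have "finite {t \<in> X. ?h t \<in> {?h u}}" by (rule finite_iter_preimage) simp
      ultimately have "finite {u..v}" by (rule finite_subset)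
      then show False using uv(3) infinite_Icc by blast
    qed
  qed
  moreover have "openin (top_of_set X) (interior P)"
    using PX interior_subset[of P] by (intro open_subset open_interior) blast
  ultimately show ?thesis
    using x by (auto simp: critical_point_def locally_invertible_at_def)
qed

text \<open>A partition for \<open>g ^^ k\<close> may have fewer intervals than \<open>g ^^ k\<close> has cuts, because a later
  iterate can undo a jump of \<open>g\<close>. But the set \<open>G\<close> of endpoints of its intervals contains the
  critical points of \<open>g ^^ k\<close>, and hence may serve as the cuts of the map \<open>g ^^ k\<close>, which gives at
  most \<open>(card G + 1) ^ m\<close> laps of its \<open>m\<close>-th iterate. The cuts of \<open>g ^^ (k * m)\<close> are pullbacks of the
  finite set of cuts of \<open>g ^^ k\<close> under iterates of \<open>g ^^ k\<close>, and these cost only a factor that is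
  linear in \<open>m\<close>. The constant \<open>3\<close> comes from \<open>card G + 1 \<le> 2 * card \<P> + 1\<close>.\<close>

lemma lap_growth_le_partition:
  assumes P: "\<P> \<in> Phi X (g ^^ k)" and fin: "finite \<P>" and k: "0 < k"
  shows "lap_growth \<le> ln (3 * real (card \<P>)) / real k"
proof -
  define G where "G = X - (\<Union>P\<in>\<P>. interior P)"
  have UP: "\<Union>\<P> = X" using P by (auto simp: Phi_def partition_on_def)
  have bdd: "bounded P" and int: "is_interval P" if "P \<in> \<P>" for P
    using that UP compact_X compact_imp_bounded bounded_subset P by (blast, auto simp: Phi_def)
  have sub: "G \<subseteq> (\<Union>P\<in>\<P>. {Inf P, Sup P})"
  proof
    fix x assume x: "x \<in> G"
    then obtain Q where Q: "Q \<in> \<P>" "x \<in> Q" using UP by (auto simp: G_def)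
    then have "x \<in> closure Q - interior Q" using x closure_subset by (auto simp: G_def)
    with interval_minus_interior[OF int bdd] Q show "x \<in> (\<Union>P\<in>\<P>. {Inf P, Sup P})" by blast
  qed
  have finU: "finite (\<Union>P\<in>\<P>. {Inf P, Sup P})" using fin by simp
  have finG: "finite G" using sub finU by (rule finite_subset)
  have "card G \<le> card (\<Union>P\<in>\<P>. {Inf P, Sup P})" using sub finU by (rule card_mono[rotated])
  also have "\<dots> \<le> (\<Sum>P\<in>\<P>. card {Inf P, Sup P})" using fin by (rule card_UN_le)
  also have "\<dots> \<le> (\<Sum>P\<in>\<P>. 2)" by (intro sum_mono) (simp add: card_insert_if)
  finally have cardG: "card G \<le> 2 * card \<P>" by simp
  have "X \<noteq> {}" using endpoints by fastforce
  then have "\<P> \<noteq> {}" using UP by auto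
  then have cardP: "1 \<le> card \<P>" using fin by (simp add: Suc_le_eq card_gt_0_iff)
  interpret lap: cut_map X "g ^^ k" G
  proof
    show "(g ^^ k) ` X \<subseteq> X" using iter_in by blast
    show "x \<in> G" if "critical_point X (g ^^ k) x" for x
      using that not_critical_in_lap[OF P] by (auto simp: G_def critical_point_def)
  qed (use interval finG in auto)
  define c where "c = 3 * real (card \<P>)"
  have c: "1 \<le> c" using cardP by (simp add: c_def)
  have le: "real (laps (k * m)) \<le> 2 * (real m + 1) * c ^ m * real (laps k)" for m
  proof -
    \<comment> \<open>An orbit meets \<open>F\<close> at time \<open>j\<close> iff the orbit of its point at time \<open>k * (j div k)\<close> does at time
      \<open>j mod k < k\<close>.\<close>
    have "cut_set X g F (k * m) \<subseteq> cut_set X (g ^^ k) (cut_set X g F k) m"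
    proof
      fix x assume "x \<in> cut_set X g F (k * m)"
      then obtain j where j: "x \<in> X" "j < k * m" "(g ^^ j) x \<in> F" by (auto simp: cut_set_def)
      have "j div k < m" using j(2) k by (simp add: less_mult_imp_div_less mult.commute)
      moreover have "(g ^^ (j mod k)) (((g ^^ k) ^^ (j div k)) x) \<in> F"
        using j(3) by (simp add: funpow_mult flip: funpow_add[THEN fun_cong, unfolded comp_apply])
      moreover have "((g ^^ k) ^^ (j div k)) x \<in> X" using lap.iter_in j(1) by blast
      ultimately show "x \<in> cut_set X (g ^^ k) (cut_set X g F k) m"
        using j(1) mod_less_divisor[OF k, of j] unfolding cut_set_def by blast
    qed
    then have "card (cut_set X g F (k * m)) \<le> card (cut_set X (g ^^ k) (cut_set X g F k) m)"
      using lap.cut_set_other(1)[OF finite_cut_set] by (intro card_mono)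
    also have "\<dots> \<le> m * (lap.laps m * laps k)"
      using lap.cut_set_other(2)[OF finite_cut_set] by (simp add: laps_def)
    finally have "real (card (cut_set X g F (k * m))) \<le> real (m * (lap.laps m * laps k))"
      by (rule of_nat_mono)
    then have 1: "real (laps (k * m)) \<le> real m * (real (lap.laps m) * real (laps k)) + 1"
      unfolding laps_def[of "k * m"] by simp
    have "real (lap.laps m) \<le> real ((card G + 1) ^ m)" by (rule of_nat_mono[OF lap.laps_le_power])
    also have "\<dots> = (real (card G) + 1) ^ m" by (simp add: add.commute)
    also have "\<dots> \<le> c ^ m" using cardG cardP unfolding c_def by (intro power_mono) auto
    finally have "real (lap.laps m) \<le> c ^ m" .
    then have 2: "real m * (real (lap.laps m) * real (laps k)) \<le> real m * (c ^ m * real (laps k))"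
      by (intro mult_left_mono mult_right_mono) auto
    have "1 * 1 \<le> c ^ m * real (laps k)"
      using c by (intro mult_mono one_le_power) (auto simp: laps_def)
    then have 3: "1 \<le> c ^ m * real (laps k)" by simp
    have "2 * (real m + 1) * c ^ m * real (laps k)
        = (real m * (c ^ m * real (laps k)) + c ^ m * real (laps k)) +
          ((real m + 1) * (c ^ m * real (laps k)))"
      by (simp add: algebra_simps)
    moreover have "0 \<le> (real m + 1) * (c ^ m * real (laps k))" using c by simp
    ultimately show ?thesis using 1 2 3 by linarith
  qed
  have lnle: "ln (real (laps (k * m))) / real (k * m) \<le>
      (ln 2 + ln (real m + 1) + real m * ln c + ln (real (laps k))) / (real k * real m)" for m
  proof -
    have "ln (real (laps (k * m))) \<le> ln (2 * (real m + 1) * c ^ m * real (laps k))"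
      using le[of m] laps_pos[of "k * m"] by simp
    also have "\<dots> = ln 2 + ln (real m + 1) + real m * ln c + ln (real (laps k))"
      using c laps_pos[of k] by (simp add: ln_mult ln_realpow del: distrib_left_numeral)
    finally have "ln (real (laps (k * m))) / real (k * m) \<le>
        (ln 2 + ln (real m + 1) + real m * ln c + ln (real (laps k))) / real (k * m)"
      by (rule divide_right_mono) simp
    then show ?thesis by simp
  qed
  have k': "0 < real k" using k by simp
  have "(\<lambda>m. (ln 2 + ln (real m + 1) + real m * L + K) / (real k * real m))
      \<longlonglongrightarrow> L * inverse (real k)" for L K :: real
    using k' by real_asymp
  then have "(\<lambda>m. (ln 2 + ln (real m + 1) + real m * ln c + ln (real (laps k))) / (real k * real m))
      \<longlonglongrightarrow> ln c / real k"
    by (simp only: divide_inverse[of "ln c"])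
  from LIMSEQ_le[OF lap_growth_LIMSEQ_multiples[OF k] this] lnle show ?thesis
    unfolding c_def by blast
qed

text \<open>The lap number lies between \<open>exp (n * lap_growth) / 3\<close> and \<open>laps n\<close>, and the constant \<open>3\<close>
  disappears in the limit.\<close>

theorem lap_count_LIMSEQ:
  "(\<lambda>n. 1 / real n * ln (real (lap_count X g n))) \<longlonglongrightarrow> lap_growth"
proof -
  have upper: "lap_count X g n \<le> laps n" for n
  proof -
    obtain \<P> where P: "\<P> \<in> Phi X (g ^^ n)" "finite \<P>" "card \<P> \<le> laps n"
      by (rule partition_at_cuts)
    then have "lap_count X g n \<le> card \<P>" unfolding lap_count_def by (intro Least_le) blast
    with P(3) show ?thesis by simp
  qed
  have attained: "\<exists>\<P>\<in>Phi X (g ^^ n). finite \<P> \<and> card \<P> = lap_count X g n" for n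
  proof -
    obtain \<P> where "\<P> \<in> Phi X (g ^^ n)" "finite \<P>" by (rule partition_at_cuts)
    then have "\<exists>\<Q>\<in>Phi X (g ^^ n). finite \<Q> \<and> card \<Q> = card \<P>" by blast
    then show ?thesis unfolding lap_count_def by (rule LeastI)
  qed
  have pos: "0 < lap_count X g n" for n
  proof -
    obtain \<P> where P: "\<P> \<in> Phi X (g ^^ n)" "finite \<P>" "card \<P> = lap_count X g n"
      using attained by blast
    have "\<Union>\<P> = X" using P(1) by (auto simp: Phi_def partition_on_def)
    moreover have "X \<noteq> {}" using endpoints by fastforce
    ultimately have "\<P> \<noteq> {}" by auto
    with P(2) have "0 < card \<P>" using card_gt_0_iff by blast
    with P(3) show ?thesis by simp
  qed
  have lower: "lap_growth - ln 3 / real n \<le> 1 / real n * ln (real (lap_count X g n))"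
    if n: "0 < n" for n
  proof -
    obtain \<P> where P: "\<P> \<in> Phi X (g ^^ n)" "finite \<P>" "card \<P> = lap_count X g n"
      using attained by blast
    have "lap_growth \<le> ln (3 * real (lap_count X g n)) / real n"
      using lap_growth_le_partition[OF P(1,2) n] P(3) by simp
    also have "\<dots> = ln 3 / real n + 1 / real n * ln (real (lap_count X g n))"
      using pos[of n] by (simp add: ln_mult add_divide_distrib)
    finally show ?thesis by linarith
  qed
  have "ln (real (lap_count X g n)) \<le> ln (real (laps n))" for n
    using pos[of n] upper[of n] by simp
  then have upper': "1 / real n * ln (real (lap_count X g n)) \<le> ln (real (laps n)) / real n" for n
    by (simp add: divide_right_mono)
  have "(\<lambda>n. ln 3 / real n) \<longlonglongrightarrow> 0" by real_asymp
  from tendsto_diff[OF tendsto_const[of lap_growth] this]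
  have "(\<lambda>n. lap_growth - ln 3 / real n) \<longlonglongrightarrow> lap_growth" by simp
  then show ?thesis
  proof (rule tendsto_sandwich[rotated 2])
    show "\<forall>\<^sub>F n in sequentially. lap_growth - ln 3 / real n \<le> 1 / real n * ln (real (lap_count X g n))"
      using lower by (auto intro: eventually_sequentiallyI[of 1])
  qed (use upper' lap_growth_LIMSEQ in auto)
qed

end

section \<open>Entropy and lap numbers of pc-maps\<close>

lemma relative_frontier_openin:
  assumes "openin (top_of_set X) Q"
  shows "top_of_set X frontier_of Q = X \<inter> closure Q - Q"
proof -
  have "top_of_set X interior_of Q = Q" using assms by (simp add: interior_of_eq)
  moreover have "X \<inter> Q = Q" using openin_imp_subset[OF assms] by blast
  ultimately show ?thesis by (simp add: frontier_of_def closure_of_subtopology)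
qed

theorem theorem2p6:
  fixes X :: "real set" and f :: "real \<Rightarrow> real" and N :: nat and Q :: "nat \<Rightarrow> real set"
  assumes "pc_map X f N Q"
  shows "(\<lambda>n. ereal (1 / real n * ln (real (lap_count X f n)))) \<longlonglongrightarrow> htop X f (Delta X N Q)"
proof -
  note pc = assms[unfolded pc_map_def]
  have X: "is_interval X" and compact: "compact X" and int: "interior X \<noteq> {}" and maps: "f ` X \<subseteq> X"
    using pc by - (elim conjE, assumption)+
  have Q: "is_interval (Q i)" "openin (top_of_set X) (Q i)" if "i \<in> {1..N}" for i
    using pc that by auto
  \<comment> \<open>The critical points outside the pieces lie in \<open>Delta X N Q\<close>; so there are only finitely many.\<close>
  have frontier: "top_of_set X frontier_of Q i = X \<inter> closure (Q i) - Q i" if "i \<in> {1..N}" for i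
    using Q(2)[OF that] by (rule relative_frontier_openin)
  have "finite (top_of_set X frontier_of Q i)" if i: "i \<in> {1..N}" for i
  proof (rule finite_subset)
    have "bounded X" using compact by (rule compact_imp_bounded)
    then have "bounded (Q i)" using openin_imp_subset[OF Q(2)[OF i]] bounded_subset by blast
    then show "top_of_set X frontier_of Q i \<subseteq> {Inf (Q i), Sup (Q i)}"
      using interval_minus_interior[OF Q(1)[OF i]] interior_subset[of "Q i"]
      unfolding frontier[OF i] by blast
  qed simp
  then have Delta: "finite (Delta X N Q)" unfolding Delta_def by blast
  have "{x. critical_point X f x} \<subseteq> Delta X N Q \<union> (\<Union>i\<in>{1..N}. {x \<in> Q i. critical_point X f x})"
  proof
    fix x assume x: "x \<in> {x. critical_point X f x}"
    have cover: "X = (\<Union>i\<in>{1..N}. closure (Q i))" using pc by (elim conjE)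
    have "x \<in> X" using x by (simp add: critical_point_def)
    then obtain i where i: "i \<in> {1..N}" "x \<in> closure (Q i)" by (subst (asm) cover) blast
    then have "x \<in> Q i \<or> x \<in> Delta X N Q"
      using \<open>x \<in> X\<close> frontier[OF i(1)] unfolding Delta_def by blast
    with x i(1) show "x \<in> Delta X N Q \<union> (\<Union>i\<in>{1..N}. {x \<in> Q i. critical_point X f x})" by blast
  qed
  moreover have "\<forall>i\<in>{1..N}. finite {x \<in> Q i. critical_point X f x}" using pc by (elim conjE)
  then have "finite (\<Union>i\<in>{1..N}. {x \<in> Q i. critical_point X f x})" by blast
  ultimately have crit: "finite {x. critical_point X f x}"
    using Delta by (meson finite_Un finite_subset)
  interpret interval_system X f "{x. critical_point X f x}" "Delta X N Q"
    using X compact int maps crit Delta by unfold_locales auto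
  show ?thesis
    using lap_count_LIMSEQ htop_eq_lap_growth by simp
qed

end
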